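(* Let $K,L\subseteq\mathbb R^n$ be convex bodies. Then, for every $\left(\frac{3}{4}\right)^n\leq\theta\leq 1$, $$ |K+_\theta L|^{\frac{1}{n}}\geq \frac{1}{2}{{2n}\choose{n}}^{\frac{1}{n}}\left(1-\theta^{\frac{1}{n}}\right)\left(|K|^{\frac{1}{n}}+|L|^{\frac{1}{n}}\right), $$ and, for every $0\leq\theta\leq \left(\frac{3}{4}\right)^n$, $$ |K+_\theta L|^{\frac{1}{n}}\geq \left(1-\left(\frac{4}{3}-\frac{1}{6}{{2n}\choose{n}}^{\frac{1}{n}}\right)\theta^{\frac{1}{n}}\right)\left(|K|^{\frac{1}{n}}+|L|^{\frac{1}{n}}\right). $$ Moreover, given any $\left(\frac{3}{4}\right)^n\leq\theta<1$, there is equality in the first inequality if and only if $K=-L$ is an $n$-dimensional simplex.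
   Context: A convex body is a compact convex subset of $\mathbb R^n$ with non-empty interior; $|\cdot|$ denotes $n$-dimensional Lebesgue measure (volume). $K+L=\{x+y: x\in K, y\in L\}$ is the Minkowski sum. Let $M(K,L)=\max_{z\in\mathbb R^n}|K\cap(z-L)|$. For $0\leq\theta\leq1$, the $\theta$-convolution body of $K$ and $L$ is $$K+_\theta L=\{z\in K+L:\ |K\cap(z-L)|\geq\theta M(K,L)\}.$$
   Formalization: In the equality case, "K = -L" is proved up to translation (K = v - L for some v, with K an n-simplex), since the literal condition K = -L is not necessary: translating L keeps equality. *)

theory Defs
  imports "HOL-Analysis.Analysis"
begin

definition convex_body :: "'a::euclidean_space set \<Rightarrow> bool" where
  "convex_body K \<longleftrightarrow> compact K \<and> convex K \<and> interior K \<noteq> {}"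

abbreviation vol :: "'a::euclidean_space set \<Rightarrow> real" where
  "vol S \<equiv> measure lebesgue S"

definition minkowski_sum :: "'a::euclidean_space set \<Rightarrow> 'a set \<Rightarrow> 'a set" where
  "minkowski_sum K L = {x + y | x y. x \<in> K \<and> y \<in> L}"

definition reflect_translate :: "'a::euclidean_space \<Rightarrow> 'a set \<Rightarrow> 'a set" where
  "reflect_translate z L = (\<lambda>y. z - y) ` L"

(* M(K,L) = max_z |K \<inter> (z - L)| (the maximum is attained for convex bodies) *)
definition Mvol :: "'a::euclidean_space set \<Rightarrow> 'a set \<Rightarrow> real" where
  "Mvol K L = (SUP z. vol (K \<inter> reflect_translate z L))"

definition conv_body :: "'a::euclidean_space set \<Rightarrow> real \<Rightarrow> 'a set \<Rightarrow> 'a set" where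
  "conv_body K \<theta> L = {z \<in> minkowski_sum K L. vol (K \<inter> reflect_translate z L) \<ge> \<theta> * Mvol K L}"

end

theory Submission
  imports Defs
begin

text \<open>
  Let \<open>C\<^sub>s\<close> be the \<open>s\<^sup>n\<close>-convolution body of \<open>K\<close> and \<open>L\<close>, let \<open>V(s) = |C\<^sub>s|\<^bsup>1/n\<^esup>\<close> and \<open>M = M(K, L)\<close>. By the
  Brunn-Minkowski inequality \<open>|K \<inter> (z - L)|\<^bsup>1/n\<^esup>\<close> is a concave function of \<open>z \<in> K + L\<close>, hence
  \<open>(1 - u) C\<^sub>a + u C\<^sub>b \<subseteq> C\<^bsub>(1 - u) a + u b\<^esub>\<close>, and by Brunn-Minkowski again \<open>V\<close> is concave on \<open>[0, 1]\<close>. The layer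
  cake formula reads \<open>|K| |L| / M = \<integral> n s\<^bsup>n-1\<^esup> V(s)\<^sup>n ds\<close>. Bounding \<open>V\<close> by a supporting line at \<open>t\<close> bounds the
  integral by a convex function of the slope, which is largest at an end of the range of slopes; for
  \<open>t \<ge> 3/4\<close> (as \<open>2n choose n < 4\<^sup>n\<close>) this is the line vanishing at \<open>1\<close>, so that
  \<open>|K| |L| / M \<le> V(t)\<^sup>n / ((2n choose n) (1 - t)\<^sup>n)\<close>. With \<open>M \<le> min |K| |L|\<close> this is the first inequality.
  The second one is the concavity of \<open>V\<close> between \<open>0\<close> and \<open>3/4\<close>.

  Equality forces \<open>|K| = |L| = M\<close>, hence \<open>K = z - L\<close>, and \<open>V(s) = (1 - s) V(0)\<close>. Since \<open>C\<^sub>s\<close> contains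
  \<open>(1 - s) (K + L) + s z\<close>, it is that homothet, which makes every nonempty \<open>K \<inter> (x + K)\<close> a homothet of \<open>K\<close>.
  In the cone over \<open>K\<close> an extreme ray is then never dominated by a sum of points on other extreme rays,
  so the extreme points of \<open>K\<close> are affinely independent.
\<close>

subsection \<open>The Brunn-Minkowski inequality\<close>

lemma emeasure_lborel_compact: "compact S \<Longrightarrow> emeasure lborel S = ennreal (vol S)"
  using emeasure_eq_ennreal_measure[of lborel S] emeasure_compact_finite[of S]
  by (simp add: borel_compact less_top)

lemma brunn_minkowski_real_compact:
  fixes A B C :: "real set"
  assumes A: "compact A" "A \<noteq> {}" and B: "compact B" "B \<noteq> {}" and C: "C \<in> sets borel"
    and l: "0 < l" "l < 1"
    and sub: "\<And>x y. x \<in> A \<Longrightarrow> y \<in> B \<Longrightarrow> (1 - l) * x + l * y \<in> C"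
  shows "ennreal (1 - l) * emeasure lborel A + ennreal l * emeasure lborel B \<le> emeasure lborel C"
proof -
  obtain a where a: "a \<in> A" "\<And>x. x \<in> A \<Longrightarrow> x \<le> a"
    using compact_attains_sup[OF A] by blast
  obtain b where b: "b \<in> B" "\<And>y. y \<in> B \<Longrightarrow> b \<le> y"
    using compact_attains_inf[OF B] by blast
  define A' where "A' = (\<lambda>x. (1 - l) *\<^sub>R x + l * b) ` A"
  define B' where "B' = (\<lambda>y. l *\<^sub>R y + (1 - l) * a) ` B"
  define p where "p = (1 - l) * a + l * b"
  have comp: "compact A'" "compact B'"
    unfolding A'_def B'_def by (intro compact_continuous_image continuous_intros A B)+
  then have [measurable]: "A' \<in> sets borel" "B' \<in> sets borel" by (auto intro: borel_compact)
  have scaled: "emeasure lborel A' = ennreal (1 - l) * emeasure lborel A"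
      "emeasure lborel B' = ennreal l * emeasure lborel B"
    using measure_lebesgue_affine[of "1 - l" "l * b" A] measure_lebesgue_affine[of l "(1 - l) * a" B]
      A B comp l
    by (simp_all add: emeasure_lborel_compact ennreal_mult A'_def B'_def)
  have "A' \<inter> (B' - {p}) = {}"
  proof -
    have "x' \<le> p" if "x' \<in> A'" for x'
      using that a(2) l by (auto simp: A'_def p_def intro!: mult_left_mono)
    moreover have "p \<le> y'" if "y' \<in> B'" for y'
      using that b(2) l by (auto simp: B'_def p_def intro!: mult_left_mono)
    ultimately show ?thesis by force
  qed
  then have "emeasure lborel A' + emeasure lborel (B' - {p}) = emeasure lborel (A' \<union> (B' - {p}))"
    by (intro plus_emeasure) auto
  also have "\<dots> \<le> emeasure lborel C"
    using sub[OF _ b(1)] sub[OF a(1)] C by (intro emeasure_mono) (auto simp: A'_def B'_def add.commute)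
  also have "emeasure lborel (B' - {p}) = emeasure lborel B'"
    by (intro emeasure_Diff_null_set) auto
  finally show ?thesis by (simp only: scaled)
qed

lemma emeasure_lborel_eq_SUP_compact:
  fixes S :: "'a::euclidean_space set"
  assumes "S \<in> sets borel"
  obtains C :: "nat \<Rightarrow> 'a set" where "\<And>k. compact (C k)" "\<And>k. C k \<subseteq> S" "incseq C"
    "emeasure lborel S = (SUP k. emeasure lborel (C k))"
proof -
  obtain N and D :: "nat \<Rightarrow> 'a set"
    where N: "negligible N" and D: "\<And>k. compact (D k)" and S: "S = (\<Union>k. D k) \<union> N"
    using lebesgue_regular_inner[of S] assms by auto
  define C where "C k = (\<Union>i\<le>k. D i)" for k
  have C: "compact (C k)" for k unfolding C_def by (intro compact_UN D) auto
  have inc: "incseq C" unfolding C_def by (intro monoI UN_mono) auto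
  have UN: "(\<Union>k. C k) = (\<Union>k. D k)" by (auto simp: C_def)
  have "emeasure lborel S = emeasure lebesgue ((\<Union>k. D k) \<union> N)"
    using assms by (simp add: S[symmetric])
  also have "\<dots> = emeasure lebesgue (\<Union>k. D k)"
    using N D by (intro emeasure_Un_null_set) (auto simp: negligible_iff_null_sets borel_compact)
  also have "\<dots> = emeasure lborel (\<Union>k. C k)"
    unfolding UN using D by (simp add: borel_compact sets.countable_UN image_subset_iff)
  also have "\<dots> = (SUP k. emeasure lborel (C k))"
    using C inc by (intro SUP_emeasure_incseq[symmetric]) (auto intro: borel_compact)
  finally show ?thesis using that[OF C _ inc] UN S by blast
qed

lemma brunn_minkowski_real:
  fixes A B C :: "real set"
  assumes A: "A \<in> sets borel" "A \<noteq> {}" and B: "B \<in> sets borel" "B \<noteq> {}" and C: "C \<in> sets borel"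
    and l: "0 < l" "l < 1"
    and sub: "\<And>x y. x \<in> A \<Longrightarrow> y \<in> B \<Longrightarrow> (1 - l) * x + l * y \<in> C"
  shows "ennreal (1 - l) * emeasure lborel A + ennreal l * emeasure lborel B \<le> emeasure lborel C"
proof -
  obtain S :: "nat \<Rightarrow> real set" where S: "\<And>k. compact (S k)" "\<And>k. S k \<subseteq> A" "incseq S"
      "emeasure lborel A = (SUP k. emeasure lborel (S k))"
    using emeasure_lborel_eq_SUP_compact[OF A(1)] by blast
  obtain T :: "nat \<Rightarrow> real set" where T: "\<And>k. compact (T k)" "\<And>k. T k \<subseteq> B" "incseq T"
      "emeasure lborel B = (SUP k. emeasure lborel (T k))"
    using emeasure_lborel_eq_SUP_compact[OF B(1)] by blast
  obtain a b where ab: "a \<in> A" "b \<in> B" using A B by blast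
  have incs: "incseq (\<lambda>k. emeasure lborel (S k))" "incseq (\<lambda>k. emeasure lborel (T k))"
    using S T by (auto intro!: monoI emeasure_mono borel_compact dest: monoD)
  have "ennreal (1 - l) * emeasure lborel (S k) + ennreal l * emeasure lborel (T k)
      \<le> emeasure lborel C" for k
  proof -
    have "ennreal (1 - l) * emeasure lborel (S k) + ennreal l * emeasure lborel (T k)
      \<le> ennreal (1 - l) * emeasure lborel (insert a (S k))
          + ennreal l * emeasure lborel (insert b (T k))"
      using S(1) T(1) by (intro add_mono mult_left_mono emeasure_mono) (auto intro: borel_compact)
    also have "\<dots> \<le> emeasure lborel C"
      using S(2) T(2) ab
      by (intro brunn_minkowski_real_compact compact_insert S(1) T(1) C l sub) auto
    finally show ?thesis .
  qed
  then have "(SUP k. ennreal (1 - l) * emeasure lborel (S k) + ennreal l * emeasure lborel (T k))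
      \<le> emeasure lborel C"
    by (rule SUP_least)
  then show ?thesis
    using incs
    by (subst (asm) ennreal_SUP_add)
      (auto simp: S(4) T(4) SUP_mult_left_ennreal intro!: monoI mult_left_mono dest: monoD)
qed

lemma nn_integral_power_Icc:
  assumes "0 \<le> b" "0 < n"
  shows "(\<integral>\<^sup>+s. ennreal (real n * s ^ (n - 1)) * indicator {0..b} s \<partial>lborel) = ennreal (b ^ n)"
proof -
  have "(\<integral>\<^sup>+s. ennreal (real n * s ^ (n - 1)) * indicator {0..b} s \<partial>lborel)
      = ennreal (b ^ n) - ennreal (0 ^ n)"
    using assms by (subst nn_integral_FTC_Icc[where F="\<lambda>s. s ^ n"])
      (auto intro!: derivative_eq_intros simp: zero_power)
  then show ?thesis using assms by (simp add: zero_power)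
qed

lemma nn_integral_power_layer_cake:
  assumes "sigma_finite_measure M" and f[measurable]: "f \<in> borel_measurable M"
    and fin: "\<And>x. x \<in> space M \<Longrightarrow> f x < \<infinity>" and n: "0 < n"
  shows "(\<integral>\<^sup>+x. f x ^ n \<partial>M) =
    (\<integral>\<^sup>+s. ennreal (real n * s ^ (n - 1)) * indicator {0..} s
      * emeasure M {x \<in> space M. ennreal s \<le> f x} \<partial>lborel)"
    (is "_ = (\<integral>\<^sup>+s. ?w s * emeasure M (?L s) \<partial>lborel)")
proof -
  interpret sigma_finite_measure M by fact
  interpret pair_sigma_finite M lborel ..
  have [measurable]: "?L s \<in> sets M" for s by measurable
  have "(\<integral>\<^sup>+s. ?w s * indicator (?L s) x \<partial>lborel) = f x ^ n" if x: "x \<in> space M" for x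
  proof -
    obtain r where r: "0 \<le> r" "f x = ennreal r" using fin[OF x] by (cases "f x") auto
    have "(\<integral>\<^sup>+s. ?w s * indicator (?L s) x \<partial>lborel)
      = (\<integral>\<^sup>+s. ennreal (real n * s ^ (n - 1)) * indicator {0..r} s \<partial>lborel)"
      by (rule nn_integral_cong) (use x r in \<open>auto split: split_indicator\<close>)
    then show ?thesis using nn_integral_power_Icc[OF r(1) n] r by (simp add: ennreal_power)
  qed
  then have "(\<integral>\<^sup>+x. f x ^ n \<partial>M) = (\<integral>\<^sup>+x. (\<integral>\<^sup>+s. ?w s * indicator (?L s) x \<partial>lborel) \<partial>M)"
    by (intro nn_integral_cong) simp
  also have "\<dots> = (\<integral>\<^sup>+s. (\<integral>\<^sup>+x. ?w s * indicator (?L s) x \<partial>M) \<partial>lborel)"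
  proof (rule Fubini'[symmetric])
    have "indicator (?L s) x = (if x \<in> space M \<and> ennreal s \<le> f x then 1 else (0::ennreal))" for x s
      by auto
    then show "(\<lambda>(x, s). ?w s * indicator (?L s) x) \<in> borel_measurable (M \<Otimes>\<^sub>M lborel)"
      by simp
  qed
  also have "\<dots> = (\<integral>\<^sup>+s. ?w s * emeasure M (?L s) \<partial>lborel)"
    by (rule nn_integral_cong) (simp add: nn_integral_cmult)
  finally show ?thesis .
qed

text \<open>\<open>a\<^bsup>1-l\<^esup> b\<^sup>l \<le> c\<close> for extended nonnegative reals, where \<open>0 \<sqdot> \<infinity> = 0\<close>: there is no real power on
  \<^typ>\<open>ennreal\<close>, so \<open>a\<close> and \<open>b\<close> are approximated from below by reals.\<close>

definition geometric_mean_le :: "real \<Rightarrow> ennreal \<Rightarrow> ennreal \<Rightarrow> ennreal \<Rightarrow> bool" where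
  "geometric_mean_le l a b c \<longleftrightarrow>
    (\<forall>x\<ge>0. \<forall>y\<ge>0. ennreal x \<le> a \<longrightarrow> ennreal y \<le> b \<longrightarrow> ennreal (x powr (1 - l) * y powr l) \<le> c)"

lemma geometric_mean_leD:
  "geometric_mean_le l a b c \<Longrightarrow> 0 \<le> x \<Longrightarrow> 0 \<le> y \<Longrightarrow> ennreal x \<le> a \<Longrightarrow> ennreal y \<le> b \<Longrightarrow>
    ennreal (x powr (1 - l) * y powr l) \<le> c"
  by (simp add: geometric_mean_le_def)

lemma geometric_mean_le_antimono:
  "geometric_mean_le l a b c \<Longrightarrow> a' \<le> a \<Longrightarrow> b' \<le> b \<Longrightarrow> geometric_mean_le l a' b' c"
  unfolding geometric_mean_le_def by (meson order_trans)

lemma geometric_mean_le_SUP: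
  fixes a b :: "nat \<Rightarrow> ennreal"
  assumes le: "\<And>k. geometric_mean_le l (a k) (b k) c" and inc: "incseq a" "incseq b"
  shows "geometric_mean_le l (SUP k. a k) (SUP k. b k) c"
  unfolding geometric_mean_le_def
proof (intro allI impI)
  fix x y :: real
  assume xy: "0 \<le> x" "0 \<le> y" "ennreal x \<le> (SUP k. a k)" "ennreal y \<le> (SUP k. b k)"
  let ?z = "x powr (1 - l) * y powr l"
  show "ennreal ?z \<le> c"
  proof (cases "x = 0 \<or> y = 0 \<or> c = \<infinity>")
    case False
    then obtain d where d: "0 \<le> d" "c = ennreal d" by (cases c) auto
    have "?z \<le> d"
    proof (rule field_le_mult_one_interval)
      fix e :: real assume e: "0 < e" "e < 1"
      have "ennreal (e * x) < ennreal x" "ennreal (e * y) < ennreal y"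
        using e xy False by (auto simp: ennreal_less_iff)
      then have "ennreal (e * x) < (SUP k. a k)" "ennreal (e * y) < (SUP k. b k)"
        using xy by (auto intro: less_le_trans)
      then obtain i j where ij: "ennreal (e * x) < a i" "ennreal (e * y) < b j"
        by (auto simp: less_SUP_iff)
      have "ennreal (e * x) \<le> a (max i j)" "ennreal (e * y) \<le> b (max i j)"
        using ij incseqD[OF inc(1), of i "max i j"] incseqD[OF inc(2), of j "max i j"] by auto
      then have "ennreal ((e * x) powr (1 - l) * (e * y) powr l) \<le> c"
        using e xy by (intro geometric_mean_leD[OF le]) auto
      also have "(e * x) powr (1 - l) * (e * y) powr l = (e powr (1 - l) * e powr l) * ?z"
        using e xy by (simp add: powr_mult)
      also have "e powr (1 - l) * e powr l = e" using e by (simp flip: powr_add)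
      finally show "e * ?z \<le> d" using d by simp
    qed
    then show ?thesis using d by simp
  qed auto
qed

lemma le_divide_ennreal_iff:
  assumes "0 \<le> s" "0 < a"
  shows "ennreal s \<le> c / ennreal a \<longleftrightarrow> ennreal (s * a) \<le> c"
  using assms by (cases c) (auto simp: divide_ennreal pos_le_divide_eq ennreal_top_divide)

lemma geometric_mean_leI_arithmetic_mean:
  assumes l: "0 < l" "l < 1" and ab: "0 < a" "0 < b"
    and le: "ennreal (1 - l) * (F / ennreal a) + ennreal l * (G / ennreal b)
      \<le> H / ennreal (a powr (1 - l) * b powr l)"
  shows "geometric_mean_le l F G H"
  unfolding geometric_mean_le_def
proof (intro allI impI)
  fix x y :: real assume xy: "0 \<le> x" "0 \<le> y" "ennreal x \<le> F" "ennreal y \<le> G"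
  define k where "k = a powr (1 - l) * b powr l"
  have k: "0 < k" using ab by (simp add: k_def)
  have "(x / a) powr (1 - l) * (y / b) powr l \<le> (1 - l) * (x / a) + l * (y / b)"
    using Youngs_inequality_0[of "1 - l" l "x / a" "y / b"] xy ab l by (cases "x = 0 \<or> y = 0") auto
  then have "ennreal ((x / a) powr (1 - l) * (y / b) powr l) \<le> ennreal ((1 - l) * (x / a) + l * (y / b))"
    by (rule ennreal_leI)
  also have "\<dots> = ennreal (1 - l) * (ennreal x / ennreal a) + ennreal l * (ennreal y / ennreal b)"
    using xy ab l by (simp add: ennreal_plus ennreal_mult divide_ennreal del: times_divide_eq_right)
  also have "\<dots> \<le> ennreal (1 - l) * (F / ennreal a) + ennreal l * (G / ennreal b)"
    using xy by (intro add_mono mult_left_mono divide_right_mono_ennreal) auto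
  also have "\<dots> \<le> H / ennreal k" using le by (simp only: k_def)
  also have "(x / a) powr (1 - l) * (y / b) powr l = x powr (1 - l) * y powr l / k"
    using xy ab by (simp add: powr_divide k_def)
  finally show "ennreal (x powr (1 - l) * y powr l) \<le> H"
    using k by (simp add: le_divide_ennreal_iff)
qed

lemma borel_measurable_emeasure_superlevel:
  fixes f :: "'a::euclidean_space \<Rightarrow> ennreal"
  assumes [measurable]: "f \<in> borel_measurable borel"
  shows "(\<lambda>s. emeasure lborel {x. ennreal s \<le> f x}) \<in> borel_measurable borel"
proof -
  have "{z \<in> space (lborel \<Otimes>\<^sub>M lborel). ennreal (fst z) \<le> f (snd z)} \<in> sets (lborel \<Otimes>\<^sub>M lborel)"
    by measurable
  from lborel.measurable_emeasure_Pair[OF this] show ?thesis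
    by (simp add: space_pair_measure vimage_def)
qed

lemma prekopa_leindler_real_normalized:
  fixes f g h :: "real \<Rightarrow> ennreal"
  assumes [measurable]: "f \<in> borel_measurable borel" "g \<in> borel_measurable borel"
    "h \<in> borel_measurable borel"
    and l: "0 < l" "l < 1" and sup: "(SUP x. f x) = 1" "(SUP x. g x) = 1"
    and le: "\<And>s x y. ennreal s \<le> f x \<Longrightarrow> ennreal s \<le> g y \<Longrightarrow> ennreal s \<le> h ((1 - l) * x + l * y)"
  shows "ennreal (1 - l) * (\<integral>\<^sup>+x. f x \<partial>lborel) + ennreal l * (\<integral>\<^sup>+x. g x \<partial>lborel) \<le> (\<integral>\<^sup>+x. h x \<partial>lborel)"
proof -
  define L where "L p s = emeasure lborel {x. ennreal s \<le> p x}" for p :: "real \<Rightarrow> ennreal" and s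
  define h' where "h' x = min 1 (h x)" for x
  have h'[measurable]: "h' \<in> borel_measurable borel" unfolding h'_def by measurable
  have le1: "f x \<le> 1" "g x \<le> 1" "h' x \<le> 1" for x
    using SUP_upper[of x UNIV f] SUP_upper[of x UNIV g] by (simp_all add: sup h'_def)
  have layer: "(\<integral>\<^sup>+x. p x \<partial>lborel) = (\<integral>\<^sup>+s\<in>{0..}. L p s \<partial>lborel)"
    if [measurable]: "p \<in> borel_measurable borel" and "\<And>x. p x \<le> 1" for p
    unfolding L_def using that(2) nn_integral_power_layer_cake[of lborel p 1]
    by (simp add: sigma_finite_lborel le_less_trans[OF _ ennreal_one_less_top] mult.commute)
  have L_concave: "ennreal (1 - l) * L f s + ennreal l * L g s \<le> L h' s" if s: "0 \<le> s" "s \<noteq> 1" for s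
  proof (cases "s < 1")
    case True
    then have "\<exists>x. ennreal s < f x" "\<exists>x. ennreal s < g x"
      using less_SUP_iff[of "ennreal s" f UNIV] less_SUP_iff[of "ennreal s" g UNIV] s by (auto simp: sup)
    then show ?thesis
      unfolding L_def using True s
      by (intro brunn_minkowski_real l) (auto simp: h'_def intro: less_imp_le le)
  next
    case False
    then have "\<not> ennreal s \<le> f x" "\<not> ennreal s \<le> g x" for x
      using le1[of x] s by (auto dest: order_trans[of _ _ 1])
    then show ?thesis by (simp add: L_def)
  qed
  have "(\<integral>\<^sup>+s\<in>{0..}. (ennreal (1 - l) * L f s + ennreal l * L g s) \<partial>lborel) \<le> (\<integral>\<^sup>+x. h' x \<partial>lborel)"
    unfolding layer[OF h' le1(3)]
  proof (rule nn_integral_mono_AE)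
    show "AE s in lborel. (ennreal (1 - l) * L f s + ennreal l * L g s) * indicator {0..} s
        \<le> L h' s * indicator {0..} s"
      using AE_lborel_singleton[of "1::real"]
      by eventually_elim (use L_concave in \<open>auto split: split_indicator\<close>)
  qed
  also have "(\<integral>\<^sup>+s\<in>{0..}. (ennreal (1 - l) * L f s + ennreal l * L g s) \<partial>lborel)
    = ennreal (1 - l) * (\<integral>\<^sup>+s\<in>{0..}. L f s \<partial>lborel) + ennreal l * (\<integral>\<^sup>+s\<in>{0..}. L g s \<partial>lborel)"
    using borel_measurable_emeasure_superlevel[OF assms(1)]
      borel_measurable_emeasure_superlevel[OF assms(2)]
    by (simp add: L_def distrib_right mult.assoc nn_integral_add nn_integral_cmult)
  also have "(\<integral>\<^sup>+x. h' x \<partial>lborel) \<le> (\<integral>\<^sup>+x. h x \<partial>lborel)" by (intro nn_integral_mono) (simp add: h'_def)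
  finally show ?thesis by (simp add: layer le1)
qed

lemma prekopa_leindler_real_bounded:
  fixes f g h :: "real \<Rightarrow> ennreal"
  assumes [measurable]: "f \<in> borel_measurable borel" "g \<in> borel_measurable borel"
    "h \<in> borel_measurable borel"
    and l: "0 < l" "l < 1" and bdd: "(SUP x. f x) < \<infinity>" "(SUP x. g x) < \<infinity>"
    and le: "\<And>x y. geometric_mean_le l (f x) (g y) (h ((1 - l) * x + l * y))"
  shows "geometric_mean_le l (\<integral>\<^sup>+x. f x \<partial>lborel) (\<integral>\<^sup>+x. g x \<partial>lborel) (\<integral>\<^sup>+x. h x \<partial>lborel)"
proof -
  obtain a b where sup: "(SUP x. f x) = ennreal a" "(SUP x. g x) = ennreal b" and ab: "0 \<le> a" "0 \<le> b"
    using bdd by (metis ennreal_cases infinity_ennreal_def less_irrefl)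
  show ?thesis
  proof (cases "a = 0 \<or> b = 0")
    case True
    then have "f = (\<lambda>_. 0) \<or> g = (\<lambda>_. 0)" using sup by (auto simp: SUP_eq_iff bot_ennreal fun_eq_iff)
    then show ?thesis by (auto simp: geometric_mean_le_def)
  next
    case False
    then have pos: "0 < a" "0 < b" using ab by auto
    define k where "k = a powr (1 - l) * b powr l"
    have k: "0 < k" using pos by (simp add: k_def)
    have "ennreal (1 - l) * (\<integral>\<^sup>+x. f x / ennreal a \<partial>lborel) + ennreal l * (\<integral>\<^sup>+x. g x / ennreal b \<partial>lborel)
        \<le> (\<integral>\<^sup>+x. h x / ennreal k \<partial>lborel)"
    proof (rule prekopa_leindler_real_normalized)
      show "(SUP x. f x / ennreal a) = 1" "(SUP x. g x / ennreal b) = 1"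
        using pos by (simp_all add: sup ennreal_divide_self flip: SUP_divide_ennreal)
      fix s x y assume s: "ennreal s \<le> f x / ennreal a" "ennreal s \<le> g y / ennreal b"
      show "ennreal s \<le> h ((1 - l) * x + l * y) / ennreal k"
      proof (cases "0 < s")
        case True
        then have "ennreal (s * a) \<le> f x" "ennreal (s * b) \<le> g y"
          using s pos by (simp_all add: le_divide_ennreal_iff)
        then have "ennreal ((s * a) powr (1 - l) * (s * b) powr l) \<le> h ((1 - l) * x + l * y)"
          using True pos by (intro geometric_mean_leD[OF le]) auto
        also have "(s * a) powr (1 - l) * (s * b) powr l = s powr (1 - l) * s powr l * k"
          using True pos by (simp add: powr_mult k_def)
        also have "s powr (1 - l) * s powr l = s" using True by (simp flip: powr_add)
        finally show ?thesis using True k by (simp add: le_divide_ennreal_iff)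
      qed (simp add: ennreal_neg)
    qed (use l in measurable)
    then show ?thesis
      using geometric_mean_leI_arithmetic_mean[OF l pos] by (simp add: k_def nn_integral_divide)
  qed
qed

lemma prekopa_leindler_real:
  fixes f g h :: "real \<Rightarrow> ennreal"
  assumes [measurable]: "f \<in> borel_measurable borel" "g \<in> borel_measurable borel"
    "h \<in> borel_measurable borel"
    and l: "0 < l" "l < 1"
    and le: "\<And>x y. geometric_mean_le l (f x) (g y) (h ((1 - l) * x + l * y))"
  shows "geometric_mean_le l (\<integral>\<^sup>+x. f x \<partial>lborel) (\<integral>\<^sup>+x. g x \<partial>lborel) (\<integral>\<^sup>+x. h x \<partial>lborel)"
proof -
  define trunc where "trunc p k x = inf (p x) (of_nat k)" for p :: "real \<Rightarrow> ennreal" and k x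
  have trunc_incseq: "incseq (trunc p)" for p
    by (auto simp: trunc_def le_fun_def intro!: monoI le_infI2[OF of_nat_mono])
  have trunc_measurable: "trunc p k \<in> borel_measurable borel"
    if [measurable]: "p \<in> borel_measurable borel" for p k
    unfolding trunc_def by measurable
  have SUP_trunc: "(SUP k. trunc p k x) = p x" for p x
    by (simp add: trunc_def ennreal_SUP_of_nat_eq_top flip: inf_SUP)
  have integral: "(\<integral>\<^sup>+x. p x \<partial>lborel) = (SUP k. \<integral>\<^sup>+x. trunc p k x \<partial>lborel)"
    if "p \<in> borel_measurable borel" for p
    using nn_integral_monotone_convergence_SUP[OF trunc_incseq[of p], of lborel]
      trunc_measurable[OF that]
    by (simp add: SUP_trunc image_comp)
  have "geometric_mean_le l (\<integral>\<^sup>+x. trunc f k x \<partial>lborel) (\<integral>\<^sup>+x. trunc g k x \<partial>lborel)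
      (\<integral>\<^sup>+x. h x \<partial>lborel)" for k
  proof (rule prekopa_leindler_real_bounded)
    have "(SUP x. trunc p k x) \<le> of_nat k" for p by (intro SUP_least) (simp add: trunc_def)
    then show "(SUP x. trunc f k x) < \<infinity>" "(SUP x. trunc g k x) < \<infinity>"
      by (metis infinity_ennreal_def of_nat_less_top order_le_less_trans)+
    show "geometric_mean_le l (trunc f k x) (trunc g k y) (h ((1 - l) * x + l * y))" for x y
      using le by (rule geometric_mean_le_antimono) (auto simp: trunc_def)
  qed (auto intro: trunc_measurable l)
  then show ?thesis
    unfolding integral[OF assms(1)] integral[OF assms(2)]
    by (rule geometric_mean_le_SUP)
      (auto intro!: monoI nn_integral_mono dest: monoD[OF trunc_incseq] le_funD)
qed

interpretation lborel_product: product_sigma_finite "\<lambda>_. lborel :: real measure" ..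

lemma borel_measurable_PiM_update:
  fixes p :: "('i \<Rightarrow> real) \<Rightarrow> ennreal"
  assumes "finite I" and p: "p \<in> borel_measurable (Pi\<^sub>M (insert i I) (\<lambda>_. lborel))"
  shows "(\<lambda>x. p (x(i := s))) \<in> borel_measurable (Pi\<^sub>M I (\<lambda>_. lborel))"
    and "(\<lambda>s. \<integral>\<^sup>+x. p (x(i := s)) \<partial>Pi\<^sub>M I (\<lambda>_. lborel)) \<in> borel_measurable borel"
proof -
  let ?M = "\<lambda>I. Pi\<^sub>M I (\<lambda>_. lborel :: real measure)"
  interpret sigma_finite_measure "?M I" by (rule lborel_product.sigma_finite[OF assms(1)])
  have update: "(\<lambda>(s, x). x(i := s)) \<in> lborel \<Otimes>\<^sub>M ?M I \<rightarrow>\<^sub>M ?M (insert i I)"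
    using measurable_compose[OF measurable_pair_swap' measurable_add_dim[of i I "\<lambda>_. lborel"]]
    by (simp add: split_beta')
  have pair: "(\<lambda>(s, x). p (x(i := s))) \<in> borel_measurable (lborel \<Otimes>\<^sub>M ?M I)"
    using measurable_compose[OF update p] by (simp add: split_beta')
  show "(\<lambda>x. p (x(i := s))) \<in> borel_measurable (?M I)"
    using measurable_Pair2[OF pair, of s] by simp
  show "(\<lambda>s. \<integral>\<^sup>+x. p (x(i := s)) \<partial>?M I) \<in> borel_measurable borel"
    using borel_measurable_nn_integral[OF pair] by simp
qed

lemma prekopa_leindler_PiM:
  fixes f g h :: "('i \<Rightarrow> real) \<Rightarrow> ennreal"
  assumes "finite I" and l: "0 < l" "l < 1"
    and "f \<in> borel_measurable (Pi\<^sub>M I (\<lambda>_. lborel))" "g \<in> borel_measurable (Pi\<^sub>M I (\<lambda>_. lborel))"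
      "h \<in> borel_measurable (Pi\<^sub>M I (\<lambda>_. lborel))"
    and "\<And>x y. geometric_mean_le l (f x) (g y) (h (\<lambda>i. (1 - l) * x i + l * y i))"
  shows "geometric_mean_le l (\<integral>\<^sup>+x. f x \<partial>Pi\<^sub>M I (\<lambda>_. lborel)) (\<integral>\<^sup>+x. g x \<partial>Pi\<^sub>M I (\<lambda>_. lborel))
    (\<integral>\<^sup>+x. h x \<partial>Pi\<^sub>M I (\<lambda>_. lborel))"
  using assms(1,4-)
proof (induction I arbitrary: f g h rule: finite_induct)
  case empty
  have "(\<lambda>i::'i. (1 - l) * undefined + l * undefined) = (\<lambda>_. undefined)" by (simp add: algebra_simps)
  then show ?case using empty(4)[of "\<lambda>_. undefined" "\<lambda>_. undefined"]
    by (simp add: PiM_empty nn_integral_count_space_finite)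
next
  case (insert i I)
  let ?M = "\<lambda>I. Pi\<^sub>M I (\<lambda>_. lborel :: real measure)"
  note slice = borel_measurable_PiM_update[OF insert.hyps(1)]
  have Fubini: "(\<integral>\<^sup>+x. p x \<partial>?M (insert i I)) = (\<integral>\<^sup>+s. \<integral>\<^sup>+x. p (x(i := s)) \<partial>?M I \<partial>lborel)"
    if "p \<in> borel_measurable (?M (insert i I))" for p
    using insert.hyps that by (intro lborel_product.product_nn_integral_insert_rev)
  show ?case
    unfolding insert.prems(1-3)[THEN Fubini]
  proof (intro prekopa_leindler_real insert.prems(1-3)[THEN slice(2)] l)
    fix s t :: real
    show "geometric_mean_le l (\<integral>\<^sup>+x. f (x(i := s)) \<partial>?M I) (\<integral>\<^sup>+x. g (x(i := t)) \<partial>?M I)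
      (\<integral>\<^sup>+x. h (x(i := (1 - l) * s + l * t)) \<partial>?M I)"
    proof (intro insert.IH insert.prems(1-3)[THEN slice(1)])
      fix x y :: "'i \<Rightarrow> real"
      have "(\<lambda>j. (1 - l) * (x(i := s)) j + l * (y(i := t)) j)
          = (\<lambda>j. (1 - l) * x j + l * y j)(i := (1 - l) * s + l * t)"
        by auto
      then show "geometric_mean_le l (f (x(i := s))) (g (y(i := t)))
          (h ((\<lambda>j. (1 - l) * x j + l * y j)(i := (1 - l) * s + l * t)))"
        using insert.prems(4)[of "x(i := s)" "y(i := t)"] by metis
    qed
  qed
qed

theorem prekopa_leindler:
  fixes f g h :: "'a::euclidean_space \<Rightarrow> ennreal"
  assumes [measurable]: "f \<in> borel_measurable borel" "g \<in> borel_measurable borel"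
    "h \<in> borel_measurable borel"
    and l: "0 < l" "l < 1"
    and le: "\<And>x y. geometric_mean_le l (f x) (g y) (h ((1 - l) *\<^sub>R x + l *\<^sub>R y))"
  shows "geometric_mean_le l (\<integral>\<^sup>+x. f x \<partial>lborel) (\<integral>\<^sup>+x. g x \<partial>lborel) (\<integral>\<^sup>+x. h x \<partial>lborel)"
proof -
  let ?M = "Pi\<^sub>M (Basis :: 'a set) (\<lambda>_. lborel :: real measure)"
  define P where "P x = (\<Sum>b\<in>Basis. x b *\<^sub>R b)" for x :: "'a \<Rightarrow> real"
  have P[measurable]: "P \<in> borel_measurable ?M" unfolding P_def by measurable
  have integral: "(\<integral>\<^sup>+x. p x \<partial>lborel) = (\<integral>\<^sup>+x. p (P x) \<partial>?M)"
    if [measurable]: "p \<in> borel_measurable borel" for p :: "'a \<Rightarrow> ennreal"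
    by (subst lborel_eq) (simp add: nn_integral_distr flip: P_def)
  have affine: "P (\<lambda>i. (1 - l) * x i + l * y i) = (1 - l) *\<^sub>R P x + l *\<^sub>R P y" for x y
    by (simp add: P_def scaleR_add_left sum.distrib scaleR_sum_right)
  show ?thesis
    unfolding assms(1-3)[THEN integral]
    by (rule prekopa_leindler_PiM) (use l le in \<open>auto simp: affine\<close>)
qed

lemma brunn_minkowski_multiplicative:
  fixes A B C :: "'a::euclidean_space set"
  assumes [measurable]: "A \<in> sets borel" "B \<in> sets borel" "C \<in> sets borel"
    and l: "0 < l" "l < 1"
    and sub: "\<And>x y. x \<in> A \<Longrightarrow> y \<in> B \<Longrightarrow> (1 - l) *\<^sub>R x + l *\<^sub>R y \<in> C"
  shows "geometric_mean_le l (emeasure lborel A) (emeasure lborel B) (emeasure lborel C)"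
proof -
  have "geometric_mean_le l (indicator A x) (indicator B y)
      (indicator C ((1 - l) *\<^sub>R x + l *\<^sub>R y))" for x y
    using sub l by (auto simp: geometric_mean_le_def mult_le_one powr_le1 split: split_indicator)
  then show ?thesis using prekopa_leindler[of "indicator A" "indicator B" "indicator C" l] l by simp
qed

definition vol_root :: "'a::euclidean_space set \<Rightarrow> real" where
  "vol_root S = root DIM('a) (vol S)"

lemma vol_root_nonneg [simp]: "0 \<le> vol_root S"
  by (simp add: vol_root_def)

lemma vol_root_power: "vol_root S ^ DIM('a) = vol S" for S :: "'a::euclidean_space set"
  by (simp add: vol_root_def)

lemma vol_root_eq_powr: "vol_root S = vol S powr (1 / real DIM('a))" for S :: "'a::euclidean_space set"
  by (simp add: vol_root_def root_powr_inverse)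

lemma vol_root_affine: "vol_root ((\<lambda>x. c *\<^sub>R x + a) ` S) = \<bar>c\<bar> * vol_root S"
  by (simp add: vol_root_def measure_lebesgue_affine real_root_mult real_root_power_cancel)

lemma vol_root_translation: "vol_root ((+) a ` S) = vol_root S"
  by (simp add: vol_root_def measure_translation)

lemma vol_mono: "compact A \<Longrightarrow> compact B \<Longrightarrow> A \<subseteq> B \<Longrightarrow> vol A \<le> vol B"
  by (intro measure_mono_fmeasurable) (auto intro: lmeasurable_compact fmeasurableD)

lemma vol_root_mono: "compact A \<Longrightarrow> compact B \<Longrightarrow> A \<subseteq> B \<Longrightarrow> vol_root A \<le> vol_root B"
  by (simp add: vol_root_def vol_mono)

lemma brunn_minkowski_pos:
  fixes A B C :: "'a::euclidean_space set"
  assumes comp: "compact A" "compact B" "compact C" and pos: "0 < vol_root A" "0 < vol_root B"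
    and sub: "\<And>x y. x \<in> A \<Longrightarrow> y \<in> B \<Longrightarrow> x + y \<in> C"
  shows "vol_root A + vol_root B \<le> vol_root C"
proof -
  let ?a = "vol_root A" and ?b = "vol_root B"
  define l where "l = ?b / (?a + ?b)"
  have l: "0 < l" "l < 1" "1 - l = ?a / (?a + ?b)" using pos by (auto simp: l_def field_simps)
  let ?A = "(\<lambda>x. (1 / ?a) *\<^sub>R x) ` A" and ?B = "(\<lambda>x. (1 / ?b) *\<^sub>R x) ` B"
    and ?C = "(\<lambda>x. (1 / (?a + ?b)) *\<^sub>R x) ` C"
  have comp': "compact ?A" "compact ?B" "compact ?C" using comp by (auto intro: compact_scaling)
  have "(1 - l) *\<^sub>R x + l *\<^sub>R y \<in> ?C" if "x \<in> ?A" "y \<in> ?B" for x y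
  proof -
    from that obtain x' y' where "x' \<in> A" "y' \<in> B" "x = (1 / ?a) *\<^sub>R x'" "y = (1 / ?b) *\<^sub>R y'"
      by blast
    then have "(1 - l) *\<^sub>R x + l *\<^sub>R y = (1 / (?a + ?b)) *\<^sub>R (x' + y')"
      unfolding l(3) using pos by (simp add: l_def scaleR_add_right)
    then show ?thesis using sub[OF \<open>x' \<in> A\<close> \<open>y' \<in> B\<close>] by blast
  qed
  then have "geometric_mean_le l (ennreal (vol ?A)) (ennreal (vol ?B)) (ennreal (vol ?C))"
    using brunn_minkowski_multiplicative[OF comp'[THEN borel_compact] l(1,2)]
    by (simp add: comp' emeasure_lborel_compact)
  moreover have "vol_root ?A = 1" "vol_root ?B = 1"
    using vol_root_affine[of "1 / ?a" 0 A] vol_root_affine[of "1 / ?b" 0 B] pos by simp_all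
  then have "vol ?A = 1" "vol ?B = 1" by (simp_all flip: vol_root_power)
  ultimately have "ennreal 1 \<le> ennreal (vol ?C)"
    using geometric_mean_leD[of l "ennreal (vol ?A)" "ennreal (vol ?B)" "ennreal (vol ?C)" 1 1] by simp
  then have "1 \<le> vol_root ?C" by (simp add: vol_root_def ennreal_le_iff2)
  also have "vol_root ?C = vol_root C / (?a + ?b)"
    using vol_root_affine[of "1 / (?a + ?b)" 0 C] pos by simp
  finally show ?thesis using pos by (simp add: field_simps)
qed

theorem brunn_minkowski:
  fixes A B C :: "'a::euclidean_space set"
  assumes A: "compact A" "A \<noteq> {}" and B: "compact B" "B \<noteq> {}" and C: "compact C"
    and sub: "\<And>x y. x \<in> A \<Longrightarrow> y \<in> B \<Longrightarrow> x + y \<in> C"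
  shows "vol_root A + vol_root B \<le> vol_root C"
proof -
  have translate_le: "vol_root S \<le> vol_root C" if "compact S" "(+) p ` S \<subseteq> C" for S p
    using vol_root_mono[OF compact_translation[OF that(1)] C that(2)] by (simp add: vol_root_translation)
  obtain a b where ab: "a \<in> A" "b \<in> B" using A B by blast
  consider (null_left) "vol_root A = 0" | (null_right) "vol_root B = 0"
    | (pos) "0 < vol_root A" "0 < vol_root B"
    using vol_root_nonneg[of A] vol_root_nonneg[of B] by linarith
  then show ?thesis
  proof cases
    case null_left
    then show ?thesis using translate_le[OF B(1), of a] sub[OF ab(1)] by auto
  next
    case null_right
    then show ?thesis using translate_le[OF A(1), of b] sub[OF _ ab(2)] by (auto simp: add.commute)
  next
    case pos
    then show ?thesis using brunn_minkowski_pos[OF A(1) B(1) C] sub by blast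
  qed
qed

corollary brunn_minkowski_convex_combination:
  fixes A B C :: "'a::euclidean_space set"
  assumes A: "compact A" "A \<noteq> {}" and B: "compact B" "B \<noteq> {}" and C: "compact C"
    and u: "0 \<le> u" "u \<le> 1"
    and sub: "\<And>x y. x \<in> A \<Longrightarrow> y \<in> B \<Longrightarrow> (1 - u) *\<^sub>R x + u *\<^sub>R y \<in> C"
  shows "(1 - u) * vol_root A + u * vol_root B \<le> vol_root C"
proof -
  have "vol_root ((*\<^sub>R) (1 - u) ` A) + vol_root ((*\<^sub>R) u ` B) \<le> vol_root C"
    using A B sub by (intro brunn_minkowski compact_scaling C) auto
  then show ?thesis
    using vol_root_affine[of "1 - u" 0 A] vol_root_affine[of u 0 B] u by simp
qed

lemma vol_pos_of_interior:
  fixes S :: "'a::euclidean_space set"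
  assumes "compact S" "interior S \<noteq> {}"
  shows "0 < vol S"
proof -
  have "\<not> negligible S"
    using negligible_subset[OF _ interior_subset] open_not_negligible[OF open_interior assms(2)] by blast
  then show ?thesis
    using assms(1) by (simp add: negligible_iff_measure lmeasurable_compact zero_less_measure_iff)
qed

lemma convex_bodyD:
  assumes "convex_body K"
  shows "compact K" "convex K" "0 < vol K" "interior K \<noteq> {}"
  using assms vol_pos_of_interior by (auto simp: convex_body_def)

lemma compact_subset_eq_of_vol_le:
  fixes A B :: "'a::euclidean_space set"
  assumes A: "compact A" and B: "compact B" "convex B"
    and sub: "A \<subseteq> B" and vol: "vol B \<le> vol A" "0 < vol B"
  shows "A = B"
proof -
  have "interior B \<noteq> {}"
    using vol(2) negligible_convex_interior[OF B(2)] negligible_imp_measure0[of B] by auto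
  then have "closure (interior B) = B"
    using convex_closure_interior[OF B(2)] closure_closed[OF compact_imp_closed[OF B(1)]] by simp
  have "vol (B - A) = vol B - vol A"
    using A B sub by (intro measurable_measure_Diff) (auto intro: lmeasurable_compact fmeasurableD)
  then have "vol (B - A) = 0" using vol measure_nonneg[of lebesgue "B - A"] by linarith
  then have "negligible (B - A)"
    using A B by (simp add: negligible_iff_measure lmeasurable_compact fmeasurable_Diff fmeasurableD)
  then have "negligible (interior B - A)"
    by (rule negligible_subset) (use interior_subset in auto)
  moreover have "open (interior B - A)" using A by (intro open_Diff open_interior compact_imp_closed)
  ultimately have "interior B \<subseteq> A" using open_not_negligible by blast
  then have "closure (interior B) \<subseteq> A" using A by (intro closure_minimal compact_imp_closed)
  then show ?thesis using \<open>closure (interior B) = B\<close> sub by blast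
qed

subsection \<open>Powers of concave functions on the unit interval\<close>

definition central_binomial_root :: "nat \<Rightarrow> real" where
  "central_binomial_root n = root n (real ((2 * n) choose n))"

lemma central_binomial_root_power: "0 < n \<Longrightarrow> central_binomial_root n ^ n = real ((2 * n) choose n)"
  by (simp add: central_binomial_root_def)

lemma central_binomial_root_pos: "0 < n \<Longrightarrow> 0 < central_binomial_root n"
  by (simp add: central_binomial_root_def)

lemma central_binomial_less:
  assumes "0 < n"
  shows "(2 * n) choose n < 4 ^ n"
proof -
  have "(2 * n) choose n < (\<Sum>k\<in>{n, 0}. (2 * n) choose k)" using assms by simp
  also have "\<dots> \<le> (\<Sum>k\<le>2 * n. (2 * n) choose k)" by (rule sum_mono2) auto
  also have "\<dots> = 4 ^ n" using choose_row_sum[of "2 * n"] by (simp add: power_mult)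
  finally show ?thesis .
qed

lemma has_integral_power_unit_interval:
  assumes "0 < n"
  shows "((\<lambda>s::real. real n * s ^ (n - 1)) has_integral 1) {0..1}"
proof -
  have "((\<lambda>s::real. real n * s ^ (n - 1)) has_integral 1 ^ n - 0 ^ n) {0..1}"
    by (rule fundamental_theorem_of_calculus)
      (auto intro!: derivative_eq_intros simp flip: has_real_derivative_iff_has_vector_derivative)
  then show ?thesis using assms by (simp add: zero_power)
qed

lemma has_integral_power_times_power_diff:
  assumes n: "0 < n"
  shows "((\<lambda>s::real. real n * s ^ (n - 1) * (1 - s) ^ n)
      has_integral 1 / real ((2 * n) choose n)) {0..1}"
proof -
  have "((\<lambda>s. real n * (s powr (real n - 1) * (1 - s) powr real n)) has_integral
      real n * Beta (real n) (1 + real n)) {0..1}"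
    using has_integral_mult_right[OF has_integral_Beta_real[of "real n" "1 + real n"], of "real n"] n
    by simp
  then have "((\<lambda>s. real n * s ^ (n - 1) * (1 - s) ^ n) has_integral
      real n * Beta (real n) (1 + real n)) {0..1}"
    by (rule has_integral_spike_interior[where a=0 and b="1::real", unfolded cbox_interval box_real])
      (use n in \<open>simp flip: powr_realpow add: of_nat_diff\<close>)
  moreover have "real n * Beta (real n) (1 + real n) = 1 / real ((2 * n) choose n)"
  proof -
    obtain m where m: "n = Suc m" using n gr0_implies_Suc by blast
    have "Gamma (real n) = fact m" "Gamma (1 + real n) = fact n"
      "Gamma (real n + (1 + real n)) = fact (2 * n)"
      using Gamma_fact[of m, where 'a=real] Gamma_fact[of n, where 'a=real]
        Gamma_fact[of "2 * n", where 'a=real]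
      by (simp_all add: m add_ac)
    moreover have "real ((2 * n) choose n) = fact (2 * n) / (fact n * fact n)"
      using binomial_fact[of n "2 * n", where 'a=real] by simp
    moreover have "real n * fact m = fact n" by (simp add: m)
    ultimately show ?thesis by (simp add: Beta_def mult.assoc[symmetric])
  qed
  ultimately show ?thesis by simp
qed

definition layer_integral :: "nat \<Rightarrow> (real \<Rightarrow> real) \<Rightarrow> ennreal" where
  "layer_integral n V = (\<integral>\<^sup>+s\<in>{0..1}. ennreal (real n * s ^ (n - 1) * V s ^ n) \<partial>lborel)"

lemma layer_integral_mono:
  assumes "\<And>s. s \<in> {0..1} \<Longrightarrow> 0 \<le> V s" "\<And>s. s \<in> {0..1} \<Longrightarrow> V s \<le> W s"
  shows "layer_integral n V \<le> layer_integral n W"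
proof -
  have "V s ^ n \<le> W s ^ n" if "s \<in> {0..1}" for s using assms that by (intro power_mono)
  then show ?thesis
    unfolding layer_integral_def
    by (intro nn_integral_mono) (auto split: split_indicator intro!: ennreal_leI mult_left_mono)
qed

lemma layer_integral_cong:
  assumes "\<And>s. 0 \<le> s \<Longrightarrow> s < 1 \<Longrightarrow> V s = W s"
  shows "layer_integral n V = layer_integral n W"
  unfolding layer_integral_def
proof (rule nn_integral_cong_AE, use AE_lborel_singleton[of "1::real"] in eventually_elim)
  case (elim s)
  show ?case using assms[of s] elim by (cases "0 \<le> s \<and> s < 1") (auto split: split_indicator)
qed

lemma layer_integral_line:
  assumes "0 < n" "0 \<le> a"
  shows "layer_integral n (\<lambda>s. a * (1 - s)) = ennreal (a ^ n / real ((2 * n) choose n))"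
  unfolding layer_integral_def
proof (rule nn_integral_has_integral_lebesgue')
  have "((\<lambda>s. a ^ n * (real n * s ^ (n - 1) * (1 - s) ^ n)) has_integral
      a ^ n * (1 / real ((2 * n) choose n))) {0..1}"
    by (intro has_integral_mult_right has_integral_power_times_power_diff assms)
  then show "((\<lambda>s. real n * s ^ (n - 1) * (a * (1 - s)) ^ n)
      has_integral a ^ n / real ((2 * n) choose n)) {0..1}"
    by (simp add: power_mult_distrib mult_ac)
qed (use assms in auto)

lemma layer_integral_affine_le:
  assumes n: "0 < n" and a: "0 \<le> a" and u: "0 \<le> u" "u \<le> 1" and t: "t < 1"
  shows "layer_integral n (\<lambda>s. a * ((1 - u) + u * ((1 - s) / (1 - t))))
    \<le> ennreal (a ^ n * ((1 - u) + u / (real ((2 * n) choose n) * (1 - t) ^ n)))"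
    (is "layer_integral n ?line \<le> ennreal ?I")
proof -
  define q where "q s = a ^ n * (1 - u) * (real n * s ^ (n - 1))
    + a ^ n * u / (1 - t) ^ n * (real n * s ^ (n - 1) * (1 - s) ^ n)" for s
  have convex: "convex_on {0..} (\<lambda>x::real. x ^ n)"
    using convex_power_odd[of n] convex_on_subset[OF convex_power_even[of n], of "{0..}"]
    by (cases "even n") auto
  have "real n * s ^ (n - 1) * ?line s ^ n \<le> q s" if s: "0 \<le> s" "s \<le> 1" for s
  proof -
    have "((1 - u) *\<^sub>R 1 + u *\<^sub>R ((1 - s) / (1 - t))) ^ n
        \<le> (1 - u) * 1 ^ n + u * ((1 - s) / (1 - t)) ^ n"
      using u s t by (intro convex_onD[OF convex]) auto
    then have "real n * s ^ (n - 1) * (a ^ n * ((1 - u) + u * ((1 - s) / (1 - t))) ^ n)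
        \<le> real n * s ^ (n - 1) * (a ^ n * ((1 - u) + u * ((1 - s) / (1 - t)) ^ n))"
      using a s by (intro mult_left_mono) auto
    also have "\<dots> = q s" by (simp add: q_def algebra_simps power_divide)
    finally show ?thesis by (simp add: power_mult_distrib)
  qed
  then have "layer_integral n ?line \<le> (\<integral>\<^sup>+s\<in>{0..1}. ennreal (q s) \<partial>lborel)"
    unfolding layer_integral_def
    by (intro nn_integral_mono) (auto split: split_indicator intro: ennreal_leI)
  also have "\<dots> = ennreal ?I"
  proof (rule nn_integral_has_integral_lebesgue')
    show "0 \<le> q s" if "s \<in> {0..1}" for s using that a u t by (simp add: q_def)
    have "(q has_integral
        a ^ n * (1 - u) * 1 + a ^ n * u / (1 - t) ^ n * (1 / real ((2 * n) choose n))) {0..1}"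
      unfolding q_def
      by (intro has_integral_add has_integral_mult_right has_integral_power_unit_interval
          has_integral_power_times_power_diff n)
    then show "(q has_integral ?I) {0..1}" by (simp add: algebra_simps)
  qed
  finally show ?thesis .
qed

lemma layer_integral_truncated_line_less:
  assumes n: "0 < n" and c: "0 \<le> c" "c < a"
  shows "layer_integral n (\<lambda>s. min c (a * (1 - s))) < layer_integral n (\<lambda>s. a * (1 - s))"
proof -
  define f where "f s =
    ennreal (real n * s ^ (n - 1) * (min c (a * (1 - s))) ^ n) * indicator {0..1} s" for s
  define g where "g s = ennreal (real n * s ^ (n - 1) * (a * (1 - s)) ^ n) * indicator {0..1} s" for s
  have f_le_g: "f s \<le> g s" for s
    unfolding f_def g_def using c
    by (auto split: split_indicator intro!: ennreal_leI mult_left_mono power_mono)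
  have "(\<integral>\<^sup>+s. f s \<partial>lborel) < (\<integral>\<^sup>+s. g s \<partial>lborel)"
  proof (rule nn_integral_less)
    have "(\<integral>\<^sup>+s. f s \<partial>lborel) \<le> (\<integral>\<^sup>+s. g s \<partial>lborel)" by (intro nn_integral_mono f_le_g)
    also have "\<dots> = ennreal (a ^ n / real ((2 * n) choose n))"
      unfolding g_def layer_integral_def[symmetric] using c by (intro layer_integral_line n) simp
    finally show "(\<integral>\<^sup>+s. f s \<partial>lborel) \<noteq> \<infinity>" by (auto simp: top_unique)
    show "\<not> (AE s in lborel. g s \<le> f s)"
    proof
      assume ae: "AE s in lborel. g s \<le> f s"
      define d where "d = 1 - c / a"
      have d: "0 < d" "d \<le> 1" using c by (auto simp: d_def field_simps)
      have strict: "f s < g s" if s: "s \<in> {0<..<d}" for s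
      proof -
        have "c < a * (1 - s)" using s c by (simp add: d_def field_simps)
        then have "c ^ n < (a * (1 - s)) ^ n" using c n by (intro power_strict_mono) auto
        then show ?thesis
          using s d n c \<open>c < a * (1 - s)\<close> by (simp add: f_def g_def ennreal_less_iff min_def)
      qed
      have "AE s in lborel. s \<notin> {0<..<d}" using ae by eventually_elim (use strict in force)
      then have "{0<..<d} \<in> null_sets lborel" by (subst AE_iff_null_sets) auto
      then show False using d by (simp add: null_sets_def)
    qed
    show "AE s in lborel. f s \<le> g s" by (simp add: f_le_g)
    show "f \<in> borel_measurable lborel" "g \<in> borel_measurable lborel"
      unfolding f_def g_def by measurable
  qed
  then show ?thesis unfolding layer_integral_def f_def g_def .
qed

lemma le_of_layer_integral_eq_line:
  fixes V :: "real \<Rightarrow> real"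
  assumes n: "0 < n" and V: "\<And>s. s \<in> {0..1} \<Longrightarrow> 0 \<le> V s" "\<And>s. s \<in> {0..1} \<Longrightarrow> V s \<le> V 0"
    and line: "\<And>s. s \<in> {0..1} \<Longrightarrow> V s \<le> a * (1 - s)"
    and eq: "layer_integral n V = layer_integral n (\<lambda>s. a * (1 - s))"
  shows "a \<le> V 0"
proof (rule ccontr)
  assume "\<not> a \<le> V 0"
  then have "layer_integral n (\<lambda>s. min (V 0) (a * (1 - s))) < layer_integral n V"
    unfolding eq using V(1)[of 0] by (intro layer_integral_truncated_line_less n) auto
  also have "\<dots> \<le> layer_integral n (\<lambda>s. min (V 0) (a * (1 - s)))"
    using V line by (intro layer_integral_mono) auto
  finally show False by simp
qed

lemma concave_on_supporting_line:
  fixes V :: "real \<Rightarrow> real"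
  assumes V: "concave_on {0..1} V" "0 \<le> V 1" "V t \<le> V 0" and t: "0 < t" "t < 1"
  obtains u where "0 \<le> u" "u \<le> 1" "\<And>s. s \<in> {0..1} \<Longrightarrow> V s \<le> V t * ((1 - u) + u * ((1 - s) / (1 - t)))"
proof -
  define m where "m = (INF r\<in>{t<..} \<inter> {0..1}. (- V t - - V r) / (t - r))"
  have m: "V s \<le> V t - m * (s - t)" if "s \<in> {0..1}" for s
    using convex_le_Inf_differential[of "{0..1}" "\<lambda>s. - V s" t s] V(1) t that
    by (simp add: concave_on_def m_def)
  have "0 \<le> m * t" using m[of 0] V(3) by simp
  then have m0: "0 \<le> m" using t by (simp add: zero_le_mult_iff)
  have m1: "m * (1 - t) \<le> V t" using m[of 1] V(2) by simp
  have "0 \<le> m * (1 - t)" using m0 t by simp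
  then have Vt: "0 \<le> V t" using m1 by linarith
  define u where "u = (if V t = 0 then 0 else m * (1 - t) / V t)"
  have "V t * ((1 - u) + u * ((1 - s) / (1 - t))) = V t - m * (s - t)" for s
  proof (cases "V t = 0")
    case True
    then have "m = 0" using m0 m1 t by (simp add: mult_le_0_iff)
    then show ?thesis by (simp add: True)
  next
    case False
    have "V t * ((1 - u) + u * ((1 - s) / (1 - t))) = V t - V t * u + V t * u * ((1 - s) / (1 - t))"
      by (simp only: algebra_simps)
    also have "V t * u = m * (1 - t)" using False by (simp add: u_def)
    also have "m * (1 - t) * ((1 - s) / (1 - t)) = m * (1 - s)" using t by simp
    finally show ?thesis by (simp add: algebra_simps)
  qed
  moreover have "0 \<le> u" "u \<le> 1" using m0 m1 t Vt by (auto simp: u_def divide_le_eq_1)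
  ultimately show ?thesis using that[of u] m by simp
qed

lemma central_binomial_times_power_less_1:
  assumes "0 < n" "3/4 \<le> t" "t < (1::real)"
  shows "real ((2 * n) choose n) * (1 - t) ^ n < 1"
proof -
  have "real ((2 * n) choose n) < 4 ^ n"
    using central_binomial_less[OF assms(1)] by (metis of_nat_less_iff of_nat_numeral of_nat_power)
  moreover have "(1 - t) ^ n \<le> (1/4) ^ n" using assms by (intro power_mono) auto
  ultimately have "real ((2 * n) choose n) * (1 - t) ^ n < 4 ^ n * (1/4) ^ n"
    using assms by (intro mult_less_le_imp_less) auto
  then show ?thesis by (simp flip: power_mult_distrib)
qed

lemma layer_integral_concave_le:
  fixes V :: "real \<Rightarrow> real"
  assumes n: "0 < n" and concave: "concave_on {0..1} V"
    and V: "\<And>s. s \<in> {0..1} \<Longrightarrow> 0 \<le> V s" "\<And>s. s \<in> {0..1} \<Longrightarrow> V s \<le> V 0" and t: "3/4 \<le> t" "t < 1"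
  defines "J \<equiv> V t ^ n / (real ((2 * n) choose n) * (1 - t) ^ n)"
  shows "layer_integral n V \<le> ennreal J"
    and "layer_integral n V = ennreal J \<Longrightarrow> s \<in> {0..1} \<Longrightarrow> V s \<le> (1 - s) * V 0"
proof -
  define C where "C = 1 / (real ((2 * n) choose n) * (1 - t) ^ n)"
  have "1 < C" using central_binomial_times_power_less_1[OF n t] t by (simp add: C_def)
  have J: "J = V t ^ n * C" by (simp add: J_def C_def)
  have Vt: "0 \<le> V t" using V(1) t by auto
  obtain u where u: "0 \<le> u" "u \<le> 1"
    and support: "\<And>s. s \<in> {0..1} \<Longrightarrow> V s \<le> V t * ((1 - u) + u * ((1 - s) / (1 - t)))"
    using concave_on_supporting_line[OF concave V(1)[of 1] V(2)[of t]] t by auto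
  have "layer_integral n V \<le> layer_integral n (\<lambda>s. V t * ((1 - u) + u * ((1 - s) / (1 - t))))"
    by (intro layer_integral_mono V(1) support)
  also have "\<dots> \<le> ennreal (V t ^ n * ((1 - u) + u * C))"
    using layer_integral_affine_le[OF n Vt u t(2)] by (simp add: C_def)
  finally have le: "layer_integral n V \<le> ennreal (V t ^ n * ((1 - u) + u * C))" .
  have endpoint: "(1 - u) + u * C = C - (1 - u) * (C - 1)" by (simp add: algebra_simps)
  have "(1 - u) + u * C \<le> C" unfolding endpoint using u \<open>1 < C\<close> by simp
  then show "layer_integral n V \<le> ennreal J"
    using Vt by (intro order_trans[OF le] ennreal_leI) (simp add: J mult_left_mono)
  show "V s \<le> (1 - s) * V 0" if eq: "layer_integral n V = ennreal J" and s: "s \<in> {0..1}" for s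
  proof (cases "V t = 0")
    case True
    then show ?thesis using support[OF s] V(1)[of 0] s by (auto intro: order_trans)
  next
    case False
    then have pos: "0 < V t ^ n" using Vt by simp
    have "V t ^ n * C \<le> V t ^ n * ((1 - u) + u * C)"
      using le u pos \<open>1 < C\<close> by (simp add: eq J ennreal_le_iff)
    then have "(1 - u) * (C - 1) \<le> 0" using pos endpoint by simp
    then have "u = 1" using u \<open>1 < C\<close> by (simp add: mult_le_0_iff)
    then have line: "V s \<le> V t / (1 - t) * (1 - s)" if "s \<in> {0..1}" for s
      using support[OF that] by simp
    have "layer_integral n V = layer_integral n (\<lambda>s. V t / (1 - t) * (1 - s))"
      unfolding eq using n Vt t
      by (subst layer_integral_line) (auto simp: J_def power_divide mult.commute)
    then have "V t / (1 - t) \<le> V 0" by (intro le_of_layer_integral_eq_line[OF n V line])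
    then have "V t / (1 - t) * (1 - s) \<le> V 0 * (1 - s)" using s by (intro mult_right_mono) auto
    then show ?thesis using line[OF s] by (simp add: mult.commute)
  qed
qed

subsection \<open>Convolution bodies\<close>

lemma mem_reflect_translate: "x \<in> reflect_translate z L \<longleftrightarrow> z - x \<in> L"
  unfolding reflect_translate_def by (auto simp: image_iff intro!: bexI[of _ "z - x"])

lemma reflect_translate_eq_affinity: "reflect_translate z L = (\<lambda>x. z + (-1) *\<^sub>R x) ` L"
  by (simp add: reflect_translate_def)

lemma reflect_translate_eq_vimage: "reflect_translate z L = (\<lambda>x. z - x) -` L"
  by (auto simp: mem_reflect_translate)

lemma compact_reflect_translate: "compact L \<Longrightarrow> compact (reflect_translate z L)"
  unfolding reflect_translate_def by (intro compact_continuous_image continuous_intros)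

lemma vol_reflect_translate: "vol (reflect_translate z L) = vol L"
  using measure_lebesgue_affine[of "-1" z L] by (simp add: reflect_translate_eq_affinity add.commute)

lemma minkowski_sum_iff: "z \<in> minkowski_sum K L \<longleftrightarrow> K \<inter> reflect_translate z L \<noteq> {}"
proof -
  have "(\<exists>x y. z = x + y \<and> x \<in> K \<and> y \<in> L) \<longleftrightarrow> (\<exists>x. x \<in> K \<and> z - x \<in> L)"
    by (metis add_diff_cancel_left' add_diff_cancel_right' diff_add_cancel add.commute)
  then show ?thesis by (auto simp: minkowski_sum_def mem_reflect_translate)
qed

lemma eventually_mem_iff_not_frontier:
  assumes lim: "(X \<longlongrightarrow> l) F" and "l \<notin> frontier B"
  shows "\<forall>\<^sub>F n in F. X n \<in> B \<longleftrightarrow> l \<in> B"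
proof (cases "l \<in> B")
  case True
  then have "l \<in> interior B" using assms(2) closure_subset by (auto simp: frontier_def)
  then have "\<forall>\<^sub>F n in F. X n \<in> interior B" by (rule topological_tendstoD[OF lim open_interior])
  then show ?thesis by eventually_elim (use True interior_subset in blast)
next
  case False
  then have "l \<in> - closure B" using assms(2) interior_subset by (auto simp: frontier_def)
  then have "\<forall>\<^sub>F n in F. X n \<in> - closure B" by (intro topological_tendstoD[OF lim]) auto
  then show ?thesis by eventually_elim (use False closure_subset in blast)
qed

lemma continuous_vol_Int_reflect_translate:
  fixes A B :: "'a::euclidean_space set"
  assumes A: "compact A" and B: "closed B" "negligible (frontier B)"
  shows "continuous_on UNIV (\<lambda>z. vol (A \<inter> reflect_translate z B))"
  unfolding continuous_on_sequentially comp_def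
proof (intro ballI allI impI)
  fix a and X :: "nat \<Rightarrow> 'a"
  assume "(\<forall>n. X n \<in> UNIV) \<and> X \<longlonglongrightarrow> a"
  then have X: "X \<longlonglongrightarrow> a" by simp
  have slice: "compact (A \<inter> reflect_translate z B)" for z
    unfolding reflect_translate_eq_vimage using A B
    by (intro compact_Int_closed closed_vimage continuous_intros)
  then have vol: "vol (A \<inter> reflect_translate z B)
      = (\<integral>x. indicator (A \<inter> reflect_translate z B) x \<partial>lebesgue)" for z
    by (simp add: lmeasurable_compact fmeasurableD)
  have "negligible (reflect_translate a (frontier B))"
    unfolding reflect_translate_eq_affinity using B(2)
    by (intro negligible_differentiable_image_negligible) (auto intro!: derivative_intros)
  then have null: "reflect_translate a (frontier B) \<in> null_sets lebesgue"
    by (simp add: negligible_iff_null_sets)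
  show "(\<lambda>n. vol (A \<inter> reflect_translate (X n) B)) \<longlonglongrightarrow> vol (A \<inter> reflect_translate a B)"
    unfolding vol
  proof (rule integral_dominated_convergence[where w="indicator A"])
    show "AE x in lebesgue. (\<lambda>n. indicator (A \<inter> reflect_translate (X n) B) x)
        \<longlonglongrightarrow> (indicator (A \<inter> reflect_translate a B) x :: real)"
      using AE_not_in[OF null]
    proof eventually_elim
      case (elim x)
      have "(\<lambda>n. X n - x) \<longlonglongrightarrow> a - x" by (intro tendsto_intros X)
      then have "\<forall>\<^sub>F n in sequentially. X n - x \<in> B \<longleftrightarrow> a - x \<in> B"
        using elim by (intro eventually_mem_iff_not_frontier) (auto simp: mem_reflect_translate)
      then have "\<forall>\<^sub>F n in sequentially. indicator (A \<inter> reflect_translate (X n) B) x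
          = (indicator (A \<inter> reflect_translate a B) x :: real)"
        by eventually_elim (auto simp: mem_reflect_translate split: split_indicator)
      then show ?case by (rule tendsto_eventually)
    qed
    show "integrable lebesgue (indicator A :: 'a \<Rightarrow> real)"
      using A by (simp add: lmeasurable_compact flip: lmeasurable_iff_integrable)
  qed (use slice in \<open>auto intro!: borel_measurable_indicator fmeasurableD lmeasurable_compact
    split: split_indicator\<close>)
qed

lemma nn_integral_emeasure_Int_reflect_translate:
  fixes A B :: "'a::euclidean_space set"
  assumes [measurable]: "A \<in> sets borel" "B \<in> sets borel"
  shows "(\<integral>\<^sup>+z. emeasure lborel (A \<inter> reflect_translate z B) \<partial>lborel)
      = emeasure lborel A * emeasure lborel B"
proof -
  have slice: "emeasure lborel (A \<inter> reflect_translate z B)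
      = (\<integral>\<^sup>+x. indicator A x * indicator B (z - x) \<partial>lborel)" for z
  proof -
    have eq: "A \<inter> reflect_translate z B = {x \<in> space borel. x \<in> A \<and> z - x \<in> B}"
      by (auto simp: mem_reflect_translate)
    have "A \<inter> reflect_translate z B \<in> sets borel" unfolding eq by measurable
    then have "emeasure lborel (A \<inter> reflect_translate z B)
        = (\<integral>\<^sup>+x. indicator (A \<inter> reflect_translate z B) x \<partial>lborel)" by simp
    also have "\<dots> = (\<integral>\<^sup>+x. indicator A x * indicator B (z - x) \<partial>lborel)"
      by (rule nn_integral_cong) (auto simp: mem_reflect_translate split: split_indicator)
    finally show ?thesis .
  qed
  have translate: "(\<integral>\<^sup>+z. indicator B (z - x) \<partial>lborel) = emeasure lborel B" for x
  proof -
    have "(\<integral>\<^sup>+z. indicator B (z - x) \<partial>lborel) = (\<integral>\<^sup>+z. indicator B (z - x) \<partial>distr lborel borel ((+) x))"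
      by (simp add: lborel_distr_plus)
    also have "\<dots> = (\<integral>\<^sup>+z. indicator B z \<partial>lborel)" by (subst nn_integral_distr) auto
    finally show ?thesis by simp
  qed
  have "(\<integral>\<^sup>+z. emeasure lborel (A \<inter> reflect_translate z B) \<partial>lborel)
      = (\<integral>\<^sup>+z. \<integral>\<^sup>+x. indicator A x * indicator B (z - x) \<partial>lborel \<partial>lborel)"
    by (simp only: slice)
  also have "\<dots> = (\<integral>\<^sup>+x. \<integral>\<^sup>+z. indicator A x * indicator B (z - x) \<partial>lborel \<partial>lborel)"
    by (rule lborel_pair.Fubini') measurable
  also have "\<dots> = (\<integral>\<^sup>+x. indicator A x * emeasure lborel B \<partial>lborel)"
    by (simp add: nn_integral_cmult translate)
  also have "\<dots> = emeasure lborel A * emeasure lborel B" by (subst nn_integral_multc) auto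
  finally show ?thesis .
qed

locale convex_body_pair =
  fixes K L :: "'a::euclidean_space set"
  assumes K: "convex_body K" and L: "convex_body L"
begin

definition slice :: "'a \<Rightarrow> 'a set" where
  "slice z = K \<inter> reflect_translate z L"

definition level :: "real \<Rightarrow> 'a set" where
  "level s = conv_body K (s ^ DIM('a)) L"

definition max_root :: real where
  "max_root = root DIM('a) (Mvol K L)"

lemma bodies: "compact K" "convex K" "interior K \<noteq> {}" "compact L" "convex L" "interior L \<noteq> {}"
  using K L by (auto simp: convex_body_def)

lemma vol_root_pos: "0 < vol_root K" "0 < vol_root L"
  using vol_pos_of_interior bodies by (auto simp: vol_root_def)

lemma compact_slice: "compact (slice z)"
  unfolding slice_def using bodies by (intro compact_Int compact_reflect_translate)

lemma slice_empty_iff: "slice z = {} \<longleftrightarrow> z \<notin> minkowski_sum K L"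
  by (simp add: slice_def minkowski_sum_iff)

lemma vol_root_slice_concave:
  assumes x: "x \<in> minkowski_sum K L" and y: "y \<in> minkowski_sum K L" and u: "0 \<le> u" "u \<le> 1"
  shows "(1 - u) * vol_root (slice x) + u * vol_root (slice y)
      \<le> vol_root (slice ((1 - u) *\<^sub>R x + u *\<^sub>R y))"
proof (rule brunn_minkowski_convex_combination)
  show "slice x \<noteq> {}" "slice y \<noteq> {}" using x y by (simp_all add: slice_empty_iff)
  fix p q assume "p \<in> slice x" "q \<in> slice y"
  then have pq: "p \<in> K" "x - p \<in> L" "q \<in> K" "y - q \<in> L" by (auto simp: slice_def mem_reflect_translate)
  have "(1 - u) *\<^sub>R (x - p) + u *\<^sub>R (y - q) \<in> L" using convexD_alt[OF bodies(5) pq(2,4) u] .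
  then show "(1 - u) *\<^sub>R p + u *\<^sub>R q \<in> slice ((1 - u) *\<^sub>R x + u *\<^sub>R y)"
    using convexD_alt[OF bodies(2) pq(1,3) u]
    by (simp add: slice_def mem_reflect_translate algebra_simps)
qed (use u compact_slice in auto)

lemma continuous_vol_slice: "continuous_on UNIV (\<lambda>z. vol (slice z))"
  unfolding slice_def using bodies
  by (intro continuous_vol_Int_reflect_translate negligible_convex_frontier compact_imp_closed)

lemma nn_integral_vol_slice: "(\<integral>\<^sup>+z. ennreal (vol (slice z)) \<partial>lborel) = ennreal (vol K * vol L)"
proof -
  have "(\<integral>\<^sup>+z. ennreal (vol (slice z)) \<partial>lborel)
      = (\<integral>\<^sup>+z. emeasure lborel (K \<inter> reflect_translate z L) \<partial>lborel)"
    by (simp add: emeasure_lborel_compact[OF compact_slice, symmetric]) (simp add: slice_def)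
  also have "\<dots> = emeasure lborel K * emeasure lborel L"
    using bodies by (intro nn_integral_emeasure_Int_reflect_translate borel_compact)
  finally show ?thesis using bodies by (simp add: emeasure_lborel_compact ennreal_mult)
qed

lemma compact_minkowski_sum: "compact (minkowski_sum K L)"
  unfolding minkowski_sum_def using bodies by (intro compact_sums)

lemma minkowski_sum_nonempty: "minkowski_sum K L \<noteq> {}"
  using bodies interior_subset unfolding minkowski_sum_def by blast

lemma vol_slice_attains_Mvol:
  obtains z where "z \<in> minkowski_sum K L" "vol (slice z) = Mvol K L"
    "\<And>y. vol (slice y) \<le> Mvol K L"
proof -
  obtain z where z: "z \<in> minkowski_sum K L" "\<And>y. y \<in> minkowski_sum K L \<Longrightarrow> vol (slice y) \<le> vol (slice z)"
    using continuous_attains_sup[OF compact_minkowski_sum minkowski_sum_nonempty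
        continuous_on_subset[OF continuous_vol_slice]] by auto
  have max: "vol (slice y) \<le> vol (slice z)" for y
    using z(2)[of y] slice_empty_iff[of y] by (cases "y \<in> minkowski_sum K L") auto
  then have "Mvol K L = vol (slice z)"
    unfolding Mvol_def slice_def[symmetric] by (intro cSup_eq_maximum) auto
  then show ?thesis using that z(1) max by simp
qed

lemma Mvol_pos: "0 < Mvol K L"
proof (rule ccontr)
  assume "\<not> 0 < Mvol K L"
  then have "vol (slice z) \<le> 0" for z using vol_slice_attains_Mvol by (metis le_less_trans not_less)
  then have "vol (slice z) = 0" for z using measure_nonneg[of lebesgue "slice z"] by (simp add: antisym)
  then show False
    using nn_integral_vol_slice vol_root_pos by (simp add: vol_root_def ennreal_eq_0_iff mult_le_0_iff)
qed

lemma max_root_pos: "0 < max_root"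
  by (simp add: max_root_def Mvol_pos)

lemma vol_root_slice_le_max_root: "vol_root (slice z) \<le> max_root"
  using vol_slice_attains_Mvol by (auto simp: vol_root_def max_root_def)

lemma max_root_le: "max_root \<le> vol_root K" "max_root \<le> vol_root L"
proof -
  obtain z where z: "vol (slice z) = Mvol K L" using vol_slice_attains_Mvol by blast
  have "vol (slice z) \<le> vol K" using compact_slice bodies(1) by (intro vol_mono) (auto simp: slice_def)
  moreover have "vol (slice z) \<le> vol (reflect_translate z L)"
    using compact_slice bodies(4) by (intro vol_mono compact_reflect_translate) (auto simp: slice_def)
  ultimately show "max_root \<le> vol_root K" "max_root \<le> vol_root L"
    using z by (simp_all add: max_root_def vol_root_def vol_reflect_translate)
qed

lemma mem_level_iff:
  assumes "0 \<le> s"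
  shows "z \<in> level s \<longleftrightarrow> z \<in> minkowski_sum K L \<and> s * max_root \<le> vol_root (slice z)"
proof -
  have "s ^ DIM('a) * Mvol K L = (s * max_root) ^ DIM('a)"
    using Mvol_pos by (simp add: max_root_def power_mult_distrib)
  then have "s ^ DIM('a) * Mvol K L \<le> vol (slice z) \<longleftrightarrow> s * max_root \<le> vol_root (slice z)"
    using assms max_root_pos vol_root_power[of "slice z"]
    by (simp add: power_mono_iff flip: vol_root_power)
  then show ?thesis by (simp add: level_def conv_body_def slice_def)
qed

lemma level_0: "level 0 = minkowski_sum K L"
  using mem_level_iff[of 0] by auto

lemma level_antimono:
  assumes "0 \<le> s" "s \<le> t"
  shows "level t \<subseteq> level s"
proof -
  have "s * max_root \<le> t * max_root" using assms max_root_pos by simp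
  then show ?thesis using assms by (auto simp: mem_level_iff)
qed

lemma level_1_nonempty: "level 1 \<noteq> {}"
  using vol_slice_attains_Mvol
  by (metis empty_iff max_root_def mem_level_iff mult_1 order_refl vol_root_def zero_le_one)

lemma compact_level:
  assumes "0 \<le> s"
  shows "compact (level s)"
proof -
  have "level s = minkowski_sum K L \<inter> {z. s * max_root \<le> root DIM('a) (vol (slice z))}"
    using assms by (auto simp: mem_level_iff vol_root_def)
  then show ?thesis
    using continuous_vol_slice
    by (auto intro!: compact_Int_closed compact_minkowski_sum closed_Collect_le continuous_intros)
qed

lemma convex_minkowski_sum: "convex (minkowski_sum K L)"
proof -
  have "minkowski_sum K L = (\<Union>x\<in>K. \<Union>y\<in>L. {x + y})" by (auto simp: minkowski_sum_def)
  then show ?thesis using convex_sums[OF bodies(2,5)] by simp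
qed

lemma level_convex_combination:
  assumes x: "x \<in> level a" and y: "y \<in> level b" and ab: "0 \<le> a" "0 \<le> b" and u: "0 \<le> u" "u \<le> 1"
  shows "(1 - u) *\<^sub>R x + u *\<^sub>R y \<in> level ((1 - u) * a + u * b)"
proof -
  have *: "x \<in> minkowski_sum K L" "a * max_root \<le> vol_root (slice x)"
      "y \<in> minkowski_sum K L" "b * max_root \<le> vol_root (slice y)"
    using x y ab by (simp_all add: mem_level_iff)
  have "((1 - u) * a + u * b) * max_root = (1 - u) * (a * max_root) + u * (b * max_root)"
    by (simp add: algebra_simps)
  also have "\<dots> \<le> (1 - u) * vol_root (slice x) + u * vol_root (slice y)"
    using * u by (intro add_mono mult_left_mono) auto
  also have "\<dots> \<le> vol_root (slice ((1 - u) *\<^sub>R x + u *\<^sub>R y))"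
    by (rule vol_root_slice_concave[OF *(1,3) u])
  finally show ?thesis
    using convexD_alt[OF convex_minkowski_sum *(1,3) u] ab u by (simp add: mem_level_iff)
qed

lemma concave_on_vol_root_level: "concave_on {0..1} (\<lambda>s. vol_root (level s))"
proof
  fix u a b :: real assume *: "0 < u" "u < 1" "a \<in> {0..1}" "b \<in> {0..1}"
  have "level s \<noteq> {}" if "s \<in> {0..1}" for s
    using level_antimono[of s 1] level_1_nonempty that by auto
  then show "(1 - u) * vol_root (level a) + u * vol_root (level b)
      \<le> vol_root (level ((1 - u) *\<^sub>R a + u *\<^sub>R b))"
    using * level_convex_combination[of _ a _ b u]
    by (intro brunn_minkowski_convex_combination compact_level) auto
qed simp

lemma vol_root_level_le_level_0: "0 \<le> s \<Longrightarrow> vol_root (level s) \<le> vol_root (level 0)"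
  using level_antimono[of 0 s] by (intro vol_root_mono compact_level) auto

lemma level_eq_superlevel:
  assumes "0 < s"
  shows "level s = {z. s \<le> vol_root (slice z) / max_root}"
proof -
  have "0 < s * max_root" using assms max_root_pos by simp
  then have "z \<in> level s \<longleftrightarrow> s * max_root \<le> vol_root (slice z)" for z
    using slice_empty_iff[of z] assms by (cases "slice z = {}") (auto simp: mem_level_iff vol_root_def)
  then show ?thesis using max_root_pos by (auto simp: pos_le_divide_eq)
qed

lemma level_empty: "1 < s \<Longrightarrow> level s = {}"
  using vol_root_slice_le_max_root max_root_pos
  by (auto simp: level_eq_superlevel not_le divide_le_eq_1 intro: le_less_trans[of _ 1])

lemma layer_integral_vol_root_level:
  defines "n \<equiv> DIM('a)"
  shows "layer_integral n (\<lambda>s. vol_root (level s)) = ennreal ((vol_root K * vol_root L / max_root) ^ n)"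
proof -
  define f where "f z = ennreal (vol_root (slice z) / max_root)" for z
  have [measurable]: "(\<lambda>z. vol (slice z)) \<in> borel_measurable borel"
    using continuous_vol_slice by (rule borel_measurable_continuous_onI)
  have f: "f \<in> borel_measurable borel"
    unfolding f_def vol_root_def root_powr_inverse[OF DIM_positive measure_nonneg] by measurable
  have superlevel: "{z. ennreal s \<le> f z} = level s" if "0 < s" for s
    using that max_root_pos by (simp add: f_def level_eq_superlevel ennreal_le_iff)
  have "layer_integral n (\<lambda>s. vol_root (level s))
      = (\<integral>\<^sup>+s. ennreal (real n * s ^ (n - 1)) * indicator {0..} s
          * emeasure lborel {z \<in> space lborel. ennreal s \<le> f z} \<partial>lborel)"
    unfolding layer_integral_def
  proof (rule nn_integral_cong_AE, use AE_lborel_singleton[of "0::real"] in eventually_elim)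
    case (elim s)
    consider (negative) "s < 0" | (unit) "0 < s" "s \<le> 1" | (large) "1 < s" using elim by linarith
    then show ?case
    proof cases
      case unit
      then have "emeasure lborel (level s) = ennreal (vol_root (level s) ^ n)"
        by (simp add: compact_level emeasure_lborel_compact n_def vol_root_power)
      then show ?thesis using unit by (simp add: superlevel ennreal_mult)
    next
      case large
      then show ?thesis by (simp add: superlevel level_empty)
    qed simp
  qed
  also have "\<dots> = (\<integral>\<^sup>+z. f z ^ n \<partial>lborel)"
    by (rule nn_integral_power_layer_cake[OF sigma_finite_lborel, symmetric])
      (simp_all add: f, simp_all add: f_def n_def)
  also have "\<dots> = (\<integral>\<^sup>+z. ennreal (1 / max_root ^ n) * ennreal (vol (slice z)) \<partial>lborel)"
    using max_root_pos
    by (intro nn_integral_cong)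
      (simp add: f_def n_def ennreal_power power_divide vol_root_power flip: ennreal_mult)
  also have "\<dots> = ennreal (1 / max_root ^ n) * ennreal (vol K * vol L)"
    by (simp add: nn_integral_cmult nn_integral_vol_slice)
  also have "\<dots> = ennreal ((vol_root K * vol_root L / max_root) ^ n)"
    using max_root_pos
    by (simp add: n_def power_divide power_mult_distrib vol_root_power flip: ennreal_mult)
  finally show ?thesis .
qed

end

lemma le_root_iff:
  assumes "0 < n" "0 \<le> a"
  shows "a \<le> root n x \<longleftrightarrow> a ^ n \<le> x"
  using real_root_le_iff[OF assms(1), of "a ^ n" x] assms by (simp add: real_root_power_cancel)

lemma root_le_iff:
  assumes "0 < n" "0 \<le> a"
  shows "root n x \<le> a \<longleftrightarrow> x \<le> a ^ n"
  using real_root_le_iff[OF assms(1), of x "a ^ n"] assms by (simp add: real_root_power_cancel)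

lemma half_sum_le_mult_divide:
  fixes a c m :: real
  assumes m: "0 < m" "m \<le> a" "m \<le> c"
  shows "(a + c) / 2 \<le> a * c / m"
    and "(a + c) / 2 = a * c / m \<longleftrightarrow> a = m \<and> c = m"
proof -
  have diff: "2 * m * (a * c / m - (a + c) / 2) = a * (c - m) + c * (a - m)"
    using m by (simp add: field_simps)
  have terms: "0 \<le> a * (c - m)" "0 \<le> c * (a - m)" using m by auto
  then have "0 \<le> 2 * m * (a * c / m - (a + c) / 2)" unfolding diff by simp
  then show "(a + c) / 2 \<le> a * c / m" using m by (simp add: zero_le_mult_iff)
  have "(a + c) / 2 = a * c / m \<longleftrightarrow> 2 * m * (a * c / m - (a + c) / 2) = 0" using m by auto
  also have "\<dots> \<longleftrightarrow> a = m \<and> c = m"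
    unfolding diff add_nonneg_eq_0_iff[OF terms] using m by auto
  finally show "(a + c) / 2 = a * c / m \<longleftrightarrow> a = m \<and> c = m" .
qed

context convex_body_pair
begin

lemma vol_root_level_0_ge: "vol_root K + vol_root L \<le> vol_root (level 0)"
  unfolding level_0 using bodies
  by (intro brunn_minkowski compact_minkowski_sum) (auto simp: minkowski_sum_def)

lemma vol_root_level_ge_linear:
  assumes "0 \<le> s" "s \<le> 1"
  shows "(1 - s) * vol_root (level 0) \<le> vol_root (level s)"
proof -
  have "(1 - s) * vol_root (level 0) + s * vol_root (level 1) \<le> vol_root (level s)"
    using concave_onD_Icc[OF concave_on_vol_root_level _ assms] by simp
  moreover have "0 \<le> s * vol_root (level 1)" using assms by simp
  ultimately show ?thesis by linarith
qed

definition linear_levels :: bool where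
  "linear_levels \<longleftrightarrow> (\<forall>s. 0 \<le> s \<longrightarrow> s < 1 \<longrightarrow> vol_root (level s) = (1 - s) * vol_root (level 0))"

lemma linear_levelsD: "linear_levels \<Longrightarrow> 0 \<le> s \<Longrightarrow> s < 1 \<Longrightarrow> vol_root (level s) = (1 - s) * vol_root (level 0)"
  unfolding linear_levels_def by blast

lemma vol_root_level_lower_bound:
  assumes t: "3/4 \<le> t" "t < 1"
  defines "Q \<equiv> vol_root K * vol_root L / max_root"
  shows "central_binomial_root DIM('a) * (1 - t) * Q \<le> vol_root (level t)"
    and "central_binomial_root DIM('a) * (1 - t) * Q = vol_root (level t) \<Longrightarrow> linear_levels"
proof -
  let ?n = "DIM('a)" and ?b = "real ((2 * DIM('a)) choose DIM('a))" and ?V = "\<lambda>s. vol_root (level s)"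
  have b: "0 < ?b * (1 - t) ^ ?n" using t by simp
  have power: "(central_binomial_root DIM('a) * (1 - t) * Q) ^ ?n = ?b * (1 - t) ^ ?n * Q ^ ?n"
    by (simp add: central_binomial_root_power power_mult_distrib)
  have V: "0 \<le> ?V s" "?V s \<le> ?V 0" if "s \<in> {0..1}" for s using that vol_root_level_le_level_0 by auto
  note bound = layer_integral_concave_le[OF DIM_positive[where 'a='a] concave_on_vol_root_level V t,
      unfolded layer_integral_vol_root_level, folded Q_def]
  have "Q ^ ?n \<le> ?V t ^ ?n / (?b * (1 - t) ^ ?n)"
    using bound(1) b by (simp add: ennreal_le_iff)
  then have "(central_binomial_root DIM('a) * (1 - t) * Q) ^ ?n \<le> ?V t ^ ?n"
    unfolding power using b by (simp add: field_simps)
  then show "central_binomial_root DIM('a) * (1 - t) * Q \<le> ?V t"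
    using t max_root_pos central_binomial_root_pos[of "DIM('a)"] by (simp add: Q_def)
  assume eq: "central_binomial_root DIM('a) * (1 - t) * Q = ?V t"
  have "Q ^ ?n = ?V t ^ ?n / (?b * (1 - t) ^ ?n)"
    using b t unfolding eq[symmetric] power by simp
  then have "?V s = (1 - s) * ?V 0" if "0 \<le> s" "s < 1" for s
    using bound(2)[of s] vol_root_level_ge_linear[of s] that by simp
  then show linear_levels unfolding linear_levels_def by blast
qed

lemma vol_root_level_0_eq:
  assumes linear: linear_levels
  defines "Q \<equiv> vol_root K * vol_root L / max_root"
  shows "vol_root (level 0) = central_binomial_root DIM('a) * Q"
proof -
  let ?n = "DIM('a)" and ?V = "\<lambda>s. vol_root (level s)"
  have Q: "0 \<le> Q" using max_root_pos by (simp add: Q_def)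
  have "ennreal (Q ^ ?n) = layer_integral ?n ?V"
    by (simp only: layer_integral_vol_root_level Q_def)
  also have "\<dots> = layer_integral ?n (\<lambda>s. ?V 0 * (1 - s))"
    using linear_levelsD[OF linear] by (intro layer_integral_cong) (metis mult.commute)
  also have "\<dots> = ennreal (?V 0 ^ ?n / real ((2 * ?n) choose ?n))"
    by (rule layer_integral_line) simp_all
  finally have "Q ^ ?n = ?V 0 ^ ?n / real ((2 * ?n) choose ?n)"
    using Q by (subst (asm) ennreal_inj) auto
  then have "?V 0 ^ ?n = (central_binomial_root DIM('a) * Q) ^ ?n"
    by (simp add: power_mult_distrib central_binomial_root_power)
  then show ?thesis using Q central_binomial_root_pos[of "DIM('a)"]
    by (subst (asm) power_eq_iff_eq_base) auto
qed

theorem vol_root_level_ge_sum: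
  assumes t: "3/4 \<le> t" "t < 1"
  defines "B \<equiv> central_binomial_root DIM('a)"
  shows "1/2 * B * (1 - t) * (vol_root K + vol_root L) \<le> vol_root (level t)"
    and "vol_root (level t) = 1/2 * B * (1 - t) * (vol_root K + vol_root L) \<longleftrightarrow>
      vol_root K = max_root \<and> vol_root L = max_root \<and> linear_levels"
proof -
  define Q where "Q = vol_root K * vol_root L / max_root"
  define h where "h = (vol_root K + vol_root L) / 2"
  note half_sum = half_sum_le_mult_divide[OF max_root_pos max_root_le, folded h_def Q_def]
  note lower_bound = vol_root_level_lower_bound[OF t, folded B_def Q_def]
  have B: "0 < B * (1 - t)" using t central_binomial_root_pos[of "DIM('a)"] by (simp add: B_def)
  have h: "1/2 * B * (1 - t) * (vol_root K + vol_root L) = B * (1 - t) * h" by (simp add: h_def)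
  have h_le: "B * (1 - t) * h \<le> B * (1 - t) * Q" using half_sum(1) B by (intro mult_left_mono) auto
  show "1/2 * B * (1 - t) * (vol_root K + vol_root L) \<le> vol_root (level t)"
    unfolding h using h_le lower_bound(1) by (rule order_trans)
  show "vol_root (level t) = 1/2 * B * (1 - t) * (vol_root K + vol_root L) \<longleftrightarrow>
      vol_root K = max_root \<and> vol_root L = max_root \<and> linear_levels"
    unfolding h
  proof
    assume "vol_root (level t) = B * (1 - t) * h"
    then have "B * (1 - t) * h = B * (1 - t) * Q" "B * (1 - t) * Q = vol_root (level t)"
      using h_le lower_bound(1) by linarith+
    moreover from this(1) have "h = Q" using B by auto
    ultimately show "vol_root K = max_root \<and> vol_root L = max_root \<and> linear_levels"
      using half_sum(2) lower_bound(2) by blast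
  next
    assume "vol_root K = max_root \<and> vol_root L = max_root \<and> linear_levels"
    then have "h = Q" and linear: linear_levels using half_sum(2) by blast+
    have "vol_root (level t) = (1 - t) * vol_root (level 0)"
      using linear_levelsD[OF linear, of t] t by simp
    also have "vol_root (level 0) = B * Q" by (rule vol_root_level_0_eq[OF linear, folded B_def Q_def])
    finally show "vol_root (level t) = B * (1 - t) * h" using \<open>h = Q\<close> by simp
  qed
qed

theorem vol_root_level_ge_interpolation:
  assumes t: "0 \<le> t" "t \<le> 3/4"
  defines "B \<equiv> central_binomial_root DIM('a)"
  shows "(1 - (4/3 - 1/6 * B) * t) * (vol_root K + vol_root L) \<le> vol_root (level t)"
proof -
  let ?S = "vol_root K + vol_root L"
  have "(1 - (4/3 - 1/6 * B) * t) * ?S = (1 - 4/3 * t) * ?S + 4/3 * t * (1/2 * B * (1 - 3/4) * ?S)"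
    by (simp add: algebra_simps)
  also have "\<dots> \<le> (1 - 4/3 * t) * vol_root (level 0) + 4/3 * t * vol_root (level (3/4))"
    using t vol_root_level_0_ge vol_root_level_ge_sum(1)[of "3/4"] unfolding B_def
    by (intro add_mono mult_left_mono) auto
  also have "\<dots> \<le> vol_root (level t)"
    using concave_onD[OF concave_on_vol_root_level, of "4/3 * t" 0 "3/4"] t by simp
  finally show ?thesis .
qed

lemma conv_body_eq_level: "0 \<le> \<theta> \<Longrightarrow> conv_body K \<theta> L = level (root DIM('a) \<theta>)"
  by (simp add: level_def)

lemma convex_level: "0 \<le> s \<Longrightarrow> convex (level s)"
  unfolding convex_alt using level_convex_combination[of _ s _ s] by (simp flip: distrib_right)

lemma level_eq_homothet:
  assumes linear: linear_levels and z0: "z0 \<in> level 1" and s: "0 \<le> s" "s < 1"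
  shows "level s = (\<lambda>z. (1 - s) *\<^sub>R z + s *\<^sub>R z0) ` minkowski_sum K L"
proof (rule compact_subset_eq_of_vol_le[symmetric])
  let ?A = "(\<lambda>z. (1 - s) *\<^sub>R z + s *\<^sub>R z0) ` minkowski_sum K L"
  have "vol_root (level s) = vol_root ?A"
    using linear_levelsD[OF linear s] s by (simp add: vol_root_affine level_0)
  then show "vol (level s) \<le> vol ?A" by (simp add: vol_root_def)
  have "0 < vol_root (level 0)" using vol_root_level_0_ge vol_root_pos by linarith
  then have "0 < (1 - s) * vol_root (level 0)" using s by simp
  then have "0 < vol_root (level s)" using vol_root_level_ge_linear[of s] s by linarith
  then show "0 < vol (level s)" by (simp add: vol_root_def)
  show "?A \<subseteq> level s"
    using level_convex_combination[OF _ z0, of _ 0 s] s by (auto simp: level_0)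
  show "compact ?A" by (intro compact_continuous_image continuous_intros compact_minkowski_sum)
qed (use s in \<open>auto intro: compact_level convex_level\<close>)

lemma eq_reflect_translate_of_max_root:
  assumes "vol_root K = max_root" "vol_root L = max_root" and z: "z \<in> level 1"
  shows "K = reflect_translate z L"
proof -
  have "vol_root K \<le> vol_root (slice z)" "vol_root L \<le> vol_root (slice z)"
    using assms by (simp_all add: mem_level_iff)
  then have vol: "vol K \<le> vol (slice z)" "vol (reflect_translate z L) \<le> vol (slice z)"
    by (simp_all add: vol_reflect_translate vol_root_def)
  have pos: "0 < vol K" "0 < vol (reflect_translate z L)"
    using vol_root_pos by (simp_all add: vol_root_def vol_reflect_translate)
  have "slice z = K"
    by (rule compact_subset_eq_of_vol_le[OF compact_slice bodies(1,2) _ vol(1) pos(1)])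
      (simp add: slice_def)
  moreover have "slice z = reflect_translate z L"
  proof (rule compact_subset_eq_of_vol_le[OF compact_slice _ _ _ vol(2) pos(2)])
    show "convex (reflect_translate z L)"
      unfolding reflect_translate_eq_affinity by (intro convex_affinity bodies)
  qed (simp_all add: slice_def compact_reflect_translate bodies)
  ultimately show ?thesis by simp
qed

end

subsection \<open>Bodies whose translates intersect in homothets\<close>

definition difference_body :: "'a::real_vector set \<Rightarrow> 'a set" where
  "difference_body K = {x - y | x y. x \<in> K \<and> y \<in> K}"

text \<open>Single points count as homothets (\<open>c = 0\<close>); the ratio is less than \<open>1\<close> because \<open>x + K \<noteq> K\<close> for
  \<open>x \<noteq> 0\<close>.\<close>

definition homothetic_intersections :: "'a::real_vector set \<Rightarrow> bool" where
  "homothetic_intersections K \<longleftrightarrow> (\<forall>x. x \<noteq> 0 \<longrightarrow> K \<inter> (+) x ` K \<noteq> {} \<longrightarrow>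
    (\<exists>c v. 0 \<le> c \<and> c < 1 \<and> K \<inter> (+) x ` K = (\<lambda>k. c *\<^sub>R k + v) ` K))"

lemma mem_Int_translation: "w \<in> K \<inter> (+) x ` K \<longleftrightarrow> w \<in> K \<and> w - x \<in> K" for x :: "'a::ab_group_add"
  by (auto simp: image_iff intro!: bexI[of _ "w - x"])

lemma difference_body_iff: "x \<in> difference_body K \<longleftrightarrow> K \<inter> (+) x ` K \<noteq> {}"
proof -
  have "(\<exists>a b. x = a - b \<and> a \<in> K \<and> b \<in> K) \<longleftrightarrow> (\<exists>w. w \<in> K \<and> w - x \<in> K)"
    by (metis diff_diff_eq2 add_diff_cancel_left')
  then show ?thesis by (auto simp: difference_body_def mem_Int_translation simp del: Int_iff)
qed

lemma scaleR_mem_difference_body: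
  assumes "convex K" "x \<in> difference_body K" "0 \<le> r" "r \<le> 1"
  shows "r *\<^sub>R x \<in> difference_body K"
proof -
  obtain a b where ab: "a \<in> K" "b \<in> K" "x = a - b" using assms by (auto simp: difference_body_def)
  have "r *\<^sub>R x = ((1 - r) *\<^sub>R b + r *\<^sub>R a) - b" by (simp add: ab algebra_simps)
  then show ?thesis
    using convexD_alt[OF assms(1) ab(2,1) assms(3,4)] ab(2) unfolding difference_body_def by blast
qed

lemma homothet_subset_Int_translation:
  assumes "convex K" "a \<in> K" "b \<in> K" "0 \<le> r" "r \<le> 1"
  shows "(\<lambda>k. (1 - r) *\<^sub>R k + r *\<^sub>R a) ` K \<subseteq> K \<inter> (+) (r *\<^sub>R (a - b)) ` K"
proof
  fix w assume "w \<in> (\<lambda>k. (1 - r) *\<^sub>R k + r *\<^sub>R a) ` K"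
  then obtain k where k: "k \<in> K" "w = (1 - r) *\<^sub>R k + r *\<^sub>R a" by auto
  have "w - r *\<^sub>R (a - b) = (1 - r) *\<^sub>R k + r *\<^sub>R b" by (simp add: k algebra_simps)
  then have "w - r *\<^sub>R (a - b) \<in> K" using convexD_alt[OF assms(1) k(1) assms(3-5)] by (simp only:)
  moreover have "w \<in> K" unfolding k(2) by (rule convexD_alt[OF assms(1) k(1) assms(2,4,5)])
  ultimately show "w \<in> K \<inter> (+) (r *\<^sub>R (a - b)) ` K" by (simp only: mem_Int_translation)
qed

lemma Int_translation_eq_homothet:
  fixes K :: "'a::euclidean_space set"
  assumes body: "convex_body K" and ab: "a \<in> K" "b \<in> K" and r: "0 \<le> r" "r < 1"
    and le: "vol_root (K \<inter> (+) (r *\<^sub>R (a - b)) ` K) \<le> (1 - r) * vol_root K"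
  shows "K \<inter> (+) (r *\<^sub>R (a - b)) ` K = (\<lambda>k. (1 - r) *\<^sub>R k + r *\<^sub>R a) ` K" (is "?B = ?A")
proof (rule compact_subset_eq_of_vol_le[symmetric])
  note K = convex_bodyD[OF body]
  show "?A \<subseteq> ?B" using homothet_subset_Int_translation[OF K(2) ab] r by simp
  show "compact ?A" by (intro compact_continuous_image continuous_intros K)
  show "compact ?B" "convex ?B"
    using K by (auto intro: compact_Int compact_translation convex_Int convex_translation)
  have vol_A: "vol_root ?A = (1 - r) * vol_root K" using r by (simp add: vol_root_affine)
  then have "vol_root ?B \<le> vol_root ?A" using le by simp
  then show "vol ?B \<le> vol ?A" by (simp add: vol_root_def)
  have "0 < vol_root ?A" using vol_A K(3) r by (simp add: vol_root_def)
  then show "0 < vol ?B"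
    using vol_mono[OF \<open>compact ?A\<close> \<open>compact ?B\<close> \<open>?A \<subseteq> ?B\<close>] by (simp add: vol_root_def)
qed

lemma homothets_eqD:
  fixes K :: "'a::real_inner set"
  assumes K: "compact K" "K \<noteq> {}" and c: "0 \<le> c"
    and eq: "(\<lambda>k. c *\<^sub>R k + v) ` K = (\<lambda>k. c *\<^sub>R k + w) ` K"
  shows "v = w"
proof -
  have "\<exists>k\<in>K. \<forall>k'\<in>K. k' \<bullet> (v - w) \<le> k \<bullet> (v - w)"
    by (intro continuous_attains_sup K continuous_intros)
  then obtain k where k: "k \<in> K" "\<And>k'. k' \<in> K \<Longrightarrow> k' \<bullet> (v - w) \<le> k \<bullet> (v - w)" by blast
  obtain k' where k': "k' \<in> K" "c *\<^sub>R k + v = c *\<^sub>R k' + w" using eq k(1) by blast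
  then have "v - w = c *\<^sub>R (k' - k)" by (simp add: algebra_simps)
  then have "(v - w) \<bullet> (v - w) = c * (k' \<bullet> (v - w) - k \<bullet> (v - w))"
    by (metis inner_diff_left inner_scaleR_left)
  also have "\<dots> \<le> 0" using c k(2)[OF k'(1)] by (simp add: mult_nonneg_nonpos)
  finally show ?thesis by (metis eq_iff_diff_eq_0 inner_ge_zero inner_eq_zero_iff order_antisym)
qed

lemma homothety_fixed_point:
  fixes K :: "'a::euclidean_space set"
  assumes "closed K" "K \<noteq> {}" "0 \<le> c" "c < 1" "(\<lambda>k. c *\<^sub>R k + v) ` K \<subseteq> K"
  obtains p where "p \<in> K" "v = (1 - c) *\<^sub>R p"
proof -
  have "\<exists>!p. p \<in> K \<and> c *\<^sub>R p + v = p"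
    using assms by (intro Banach_fix[where c=c])
      (auto simp: complete_eq_closed dist_norm simp flip: scaleR_diff_right)
  then obtain p where "p \<in> K" "c *\<^sub>R p + v = p" by blast
  then show ?thesis using that[of p] by (simp add: algebra_simps)
qed

lemma homothetic_intersectionsE:
  fixes K :: "'a::euclidean_space set"
  assumes "homothetic_intersections K" "compact K" "x \<noteq> 0" "K \<inter> (+) x ` K \<noteq> {}"
  obtains c p q where "0 \<le> c" "c < 1" "p \<in> K" "q \<in> K" "x = (1 - c) *\<^sub>R (p - q)"
    "K \<inter> (+) x ` K = (\<lambda>k. c *\<^sub>R k + (1 - c) *\<^sub>R p) ` K"
proof -
  obtain c v where c: "0 \<le> c" "c < 1" and eq: "K \<inter> (+) x ` K = (\<lambda>k. c *\<^sub>R k + v) ` K"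
    using assms unfolding homothetic_intersections_def by blast
  have "c *\<^sub>R k + v \<in> K" "c *\<^sub>R k + v - x \<in> K" if "k \<in> K" for k
    using that eq mem_Int_translation[of "c *\<^sub>R k + v" K x] by blast+
  then have "(\<lambda>k. c *\<^sub>R k + v) ` K \<subseteq> K" "(\<lambda>k. c *\<^sub>R k + (v - x)) ` K \<subseteq> K" by (auto simp: algebra_simps)
  moreover have "closed K" "K \<noteq> {}" using assms by (auto intro: compact_imp_closed)
  ultimately obtain p q where pq: "p \<in> K" "q \<in> K" and v: "v = (1 - c) *\<^sub>R p"
    and vx: "v - x = (1 - c) *\<^sub>R q"
    using c by (metis homothety_fixed_point)
  have "x = v - (1 - c) *\<^sub>R q" by (simp flip: vx)
  then have "x = (1 - c) *\<^sub>R (p - q)" by (simp add: v scaleR_diff_right)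
  then show ?thesis using that[OF c pq] eq v by simp
qed

text \<open>For convex \<open>K\<close> the converse implication always holds, so that \<open>|K \<inter> (x + K)|\<^bsup>1/n\<^esup>\<close> is an affine
  function of the gauge of \<open>K - K\<close> at \<open>x\<close>.\<close>

definition linear_covariogram :: "'a::euclidean_space set \<Rightarrow> bool" where
  "linear_covariogram K \<longleftrightarrow> (\<forall>x s. 0 < s \<longrightarrow> s < 1 \<longrightarrow>
    s * vol_root K \<le> vol_root (K \<inter> (+) x ` K) \<longrightarrow> x \<in> (*\<^sub>R) (1 - s) ` difference_body K)"

lemma linear_covariogramI_homothetic:
  fixes K :: "'a::euclidean_space set"
  assumes body: "convex_body K" and homothetic: "homothetic_intersections K"
  shows "linear_covariogram K"
  unfolding linear_covariogram_def
proof (intro allI impI)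
  note K = convex_bodyD[OF body]
  fix x s assume s: "0 < s" "s < 1" "s * vol_root K \<le> vol_root (K \<inter> (+) x ` K)"
  have pos: "0 < vol_root K" using K(3) by (simp add: vol_root_def)
  then have nonempty: "K \<inter> (+) x ` K \<noteq> {}" using s by (auto simp: vol_root_def mult_le_0_iff)
  show "x \<in> (*\<^sub>R) (1 - s) ` difference_body K"
  proof (cases "x = 0")
    case True
    then show ?thesis using nonempty by (auto simp: difference_body_iff intro!: image_eqI[of _ _ 0])
  next
    case False
    obtain c p q where c: "0 \<le> c" "c < 1" "p \<in> K" "q \<in> K" and x: "x = (1 - c) *\<^sub>R (p - q)"
      and eq: "K \<inter> (+) x ` K = (\<lambda>k. c *\<^sub>R k + (1 - c) *\<^sub>R p) ` K"
      using homothetic_intersectionsE[OF homothetic K(1) False nonempty] by blast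
    have "s \<le> c" using s(3) pos c unfolding eq by (simp add: vol_root_affine)
    then have "((1 - c) / (1 - s)) *\<^sub>R (p - q) \<in> difference_body K"
      using c s by (intro scaleR_mem_difference_body K) (auto simp: difference_body_def)
    moreover have "x = (1 - s) *\<^sub>R ((1 - c) / (1 - s)) *\<^sub>R (p - q)" using s by (simp add: x)
    ultimately show ?thesis by blast
  qed
qed

lemma vol_root_Int_translation_less:
  fixes K :: "'a::euclidean_space set"
  assumes body: "convex_body K" and x: "x \<noteq> 0"
  shows "vol_root (K \<inter> (+) x ` K) < vol_root K"
proof (rule ccontr)
  note K = convex_bodyD[OF body]
  assume "\<not> vol_root (K \<inter> (+) x ` K) < vol_root K"
  then have "K \<inter> (+) x ` K = K"
    using K by (intro compact_subset_eq_of_vol_le compact_Int compact_translation)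
      (auto simp: vol_root_def)
  then have "K = (+) x ` K"
    using K by (intro compact_subset_eq_of_vol_le compact_translation convex_translation)
      (auto simp: measure_translation)
  then have "(\<lambda>k. 1 *\<^sub>R k + 0) ` K = (\<lambda>k. 1 *\<^sub>R k + x) ` K" by (simp add: add.commute[of _ x])
  moreover have "K \<noteq> {}" using K(3) by auto
  ultimately show False using homothets_eqD[of K 1 0 x] K(1) x by simp
qed

context
  fixes K :: "'a::euclidean_space set"
  assumes body: "convex_body K" and linear: "linear_covariogram K"
begin

lemma linear_covariogramE:
  assumes "0 < s" "s < 1" "s * vol_root K \<le> vol_root (K \<inter> (+) x ` K)"
  obtains a b where "a \<in> K" "b \<in> K" "x = (1 - s) *\<^sub>R (a - b)"
  using linear assms unfolding linear_covariogram_def difference_body_def by blast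

lemma vol_root_Int_half_translation_le:
  assumes "vol_root (K \<inter> (+) x ` K) = 0"
  shows "vol_root (K \<inter> (+) ((1 / 2) *\<^sub>R x) ` K) \<le> 1 / 2 * vol_root K"
proof (rule ccontr)
  note K = convex_bodyD[OF body]
  let ?g = "vol_root (K \<inter> (+) ((1 / 2) *\<^sub>R x) ` K) / vol_root K"
  have pos: "0 < vol_root K" using K(3) by (simp add: vol_root_def)
  assume "\<not> vol_root (K \<inter> (+) ((1 / 2) *\<^sub>R x) ` K) \<le> 1 / 2 * vol_root K"
  then have half: "1 / 2 < ?g" using pos by (simp add: field_simps)
  define s where "s = min ?g (3 / 4)"
  have s: "1 / 2 < s" "s < 1" "s * vol_root K \<le> vol_root (K \<inter> (+) ((1 / 2) *\<^sub>R x) ` K)"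
    using half pos by (auto simp: s_def simp flip: pos_le_divide_eq)
  then obtain a b where ab: "a \<in> K" "b \<in> K" "(1 / 2) *\<^sub>R x = (1 - s) *\<^sub>R (a - b)"
    using linear_covariogramE[of s] by auto
  define r where "r = 2 * (1 - s)"
  have r: "0 \<le> r" "r < 1" using s by (auto simp: r_def)
  have "x = 2 *\<^sub>R (1 / 2) *\<^sub>R x" by simp
  also have "\<dots> = r *\<^sub>R (a - b)" unfolding ab(3) r_def by simp
  finally have "(\<lambda>k. (1 - r) *\<^sub>R k + r *\<^sub>R a) ` K \<subseteq> K \<inter> (+) x ` K"
    using homothet_subset_Int_translation[OF K(2) ab(1,2), of r] r by simp
  then have "vol_root ((\<lambda>k. (1 - r) *\<^sub>R k + r *\<^sub>R a) ` K) \<le> vol_root (K \<inter> (+) x ` K)"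
    by (intro vol_root_mono compact_Int compact_translation compact_continuous_image continuous_intros K)
  then have "(1 - r) * vol_root K \<le> 0" using assms r by (simp add: vol_root_affine)
  then show False using r pos by (simp add: mult_le_0_iff)
qed

lemma Int_translation_singleton:
  assumes vol: "vol_root (K \<inter> (+) x ` K) = 0" and a: "a \<in> K \<inter> (+) x ` K"
  shows "K \<inter> (+) x ` K = {a}"
proof -
  \<comment> \<open>Translating by \<open>x / 2\<close> leaves a body, which is the homothet of \<open>K\<close> with centre \<open>w\<close> for every such \<open>w\<close>.\<close>
  have half: "K \<inter> (+) ((1 / 2) *\<^sub>R x) ` K = (\<lambda>k. (1 / 2) *\<^sub>R k + (1 / 2) *\<^sub>R w) ` K"
    if "w \<in> K \<inter> (+) x ` K" for w
    using Int_translation_eq_homothet[OF body, of w "w - x" "1 / 2"] that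
      vol_root_Int_half_translation_le[OF vol]
    unfolding mem_Int_translation by simp
  have "w = a" if "w \<in> K \<inter> (+) x ` K" for w
    using homothets_eqD[of K "1 / 2" "(1 / 2) *\<^sub>R w" "(1 / 2) *\<^sub>R a"]
      half[OF a] half[OF that] a convex_bodyD(1)[OF body]
    by auto
  then show ?thesis using a by blast
qed

lemma homothetic_intersections_of_linear_covariogram: "homothetic_intersections K"
  unfolding homothetic_intersections_def
proof (intro allI impI)
  fix x :: 'a assume x: "x \<noteq> 0" "K \<inter> (+) x ` K \<noteq> {}"
  define c where "c = vol_root (K \<inter> (+) x ` K) / vol_root K"
  have pos: "0 < vol_root K" using convex_bodyD(3)[OF body] by (simp add: vol_root_def)
  then have vol: "vol_root (K \<inter> (+) x ` K) = c * vol_root K" by (simp add: c_def)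
  have c: "0 \<le> c" "c < 1"
    using vol_root_Int_translation_less[OF body x(1)] pos by (simp_all add: c_def)
  show "\<exists>c v. 0 \<le> c \<and> c < 1 \<and> K \<inter> (+) x ` K = (\<lambda>k. c *\<^sub>R k + v) ` K"
  proof (cases "c = 0")
    case True
    obtain a where a: "a \<in> K \<inter> (+) x ` K" using x by blast
    then have "K \<inter> (+) x ` K = (\<lambda>k. 0 *\<^sub>R k + a) ` K"
      using Int_translation_singleton[OF _ a] True vol by auto
    then show ?thesis by (intro exI[of _ 0] exI[of _ a]) simp
  next
    case False
    then obtain a b where ab: "a \<in> K" "b \<in> K" "x = (1 - c) *\<^sub>R (a - b)"
      using linear_covariogramE[of c x] c vol by auto
    then have "K \<inter> (+) x ` K = (\<lambda>k. c *\<^sub>R k + (1 - c) *\<^sub>R a) ` K"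
      using Int_translation_eq_homothet[OF body ab(1,2), of "1 - c"] c False vol by simp
    then show ?thesis using c by blast
  qed
qed

end

subsection \<open>Simplices\<close>

lemma extreme_point_convex_combinationD:
  assumes x: "x extreme_point_of S" and ab: "a \<in> S" "b \<in> S" and c: "0 \<le> c" "c < 1"
    and eq: "x = c *\<^sub>R a + (1 - c) *\<^sub>R b"
  shows "b = x"
proof (cases "c = 0 \<or> a = b")
  case True
  then show ?thesis using eq by (auto simp flip: scaleR_add_left)
next
  case False
  then have "x \<in> open_segment b a"
    using c eq by (auto simp: in_segment add.commute intro!: exI[of _ c])
  then show ?thesis using x ab by (simp add: extreme_point_of_def)
qed

definition homogeneous :: "'a \<Rightarrow> real \<times> 'a" where
  "homogeneous k = (1, k)"

definition cone_over :: "'a::real_vector set \<Rightarrow> (real \<times> 'a) set" where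
  "cone_over K = convex_cone hull (homogeneous ` K)"

lemma convex_cone_cone_over: "convex_cone (cone_over K)"
  unfolding cone_over_def by (rule convex_cone_convex_cone_hull)

lemma scaleR_homogeneous_mem_cone_over: "k \<in> K \<Longrightarrow> 0 \<le> c \<Longrightarrow> c *\<^sub>R homogeneous k \<in> cone_over K"
  by (intro convex_cone_scaleR convex_cone_cone_over) (auto simp: cone_over_def hull_inc)

lemma sum_homogeneous_mem_cone_over:
  "(\<And>k. k \<in> B \<Longrightarrow> k \<in> K \<and> 0 \<le> c k) \<Longrightarrow> (\<Sum>k\<in>B. c k *\<^sub>R homogeneous k) \<in> cone_over K"
  by (induction B rule: infinite_finite_induct)
    (auto simp: convex_cone_contains_0 convex_cone_cone_over
      intro!: convex_cone_add scaleR_homogeneous_mem_cone_over)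

lemma mem_cone_over_iff:
  assumes "convex K" "K \<noteq> {}"
  shows "(h, z) \<in> cone_over K \<longleftrightarrow> 0 \<le> h \<and> (\<exists>k\<in>K. z = h *\<^sub>R k)"
proof -
  have eq: "homogeneous ` K = {1} \<times> K" by (auto simp: homogeneous_def)
  have "convex hull (homogeneous ` K) = homogeneous ` K"
    unfolding eq using assms(1) by (intro hull_same convex_Times) auto
  then show ?thesis
    using assms by (auto simp: cone_over_def convex_cone_hull_convex_hull_nonempty homogeneous_def)
qed

context
  fixes K :: "'a::euclidean_space set"
  assumes K: "compact K" "convex K" and homothetic: "homothetic_intersections K"
begin

lemma Int_extreme_translation_eq_homothet:
  assumes e: "e extreme_point_of K" and y: "y extreme_point_of K" and "e \<noteq> y" and r: "0 < r" "r \<le> 1"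
  shows "K \<inter> (+) (r *\<^sub>R (y - e)) ` K = (\<lambda>k. (1 - r) *\<^sub>R k + r *\<^sub>R y) ` K"
proof -
  let ?x = "r *\<^sub>R (y - e)"
  have eK: "e \<in> K" and yK: "y \<in> K" using e y by (auto simp: extreme_point_of_def)
  note sub = homothet_subset_Int_translation[OF K(2) yK eK, of r]
  have "?x \<noteq> 0" "K \<inter> (+) ?x ` K \<noteq> {}" using sub r \<open>e \<noteq> y\<close> yK by auto
  then obtain c p q where c: "0 \<le> c" "c < 1" and pq: "p \<in> K" "q \<in> K" and x: "?x = (1 - c) *\<^sub>R (p - q)"
    and eq: "K \<inter> (+) ?x ` K = (\<lambda>k. c *\<^sub>R k + (1 - c) *\<^sub>R p) ` K"
    using homothetic_intersectionsE[OF homothetic K(1)] by blast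
  have sub': "(\<lambda>k. (1 - r) *\<^sub>R k + r *\<^sub>R y) ` K \<subseteq> (\<lambda>k. c *\<^sub>R k + (1 - c) *\<^sub>R p) ` K"
    using sub r unfolding eq by simp
  obtain k where k: "k \<in> K" "(1 - r) *\<^sub>R y + r *\<^sub>R y = c *\<^sub>R k + (1 - c) *\<^sub>R p" using sub' yK by blast
  obtain k' where k': "k' \<in> K" "(1 - r) *\<^sub>R e + r *\<^sub>R y = c *\<^sub>R k' + (1 - c) *\<^sub>R p"
    using sub' eK by blast
  have "y = c *\<^sub>R k + (1 - c) *\<^sub>R p" using k(2) by (simp flip: scaleR_add_left)
  then have "p = y" by (rule extreme_point_convex_combinationD[OF y k(1) pq(1) c])
  have "e = ((1 - r) *\<^sub>R e + r *\<^sub>R y) - ?x" by (simp add: algebra_simps)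
  also have "\<dots> = c *\<^sub>R k' + (1 - c) *\<^sub>R q" unfolding k'(2) x by (simp add: algebra_simps)
  finally have "q = e" by (rule extreme_point_convex_combinationD[OF e k'(1) pq(2) c])
  have "r = 1 - c" using x \<open>e \<noteq> y\<close> unfolding \<open>p = y\<close> \<open>q = e\<close> by simp
  then show ?thesis using eq \<open>p = y\<close> by simp
qed

lemma Int_extreme_translation_empty:
  assumes e: "e extreme_point_of K" and y: "y extreme_point_of K" and "e \<noteq> y" and r: "1 < r"
  shows "K \<inter> (+) (r *\<^sub>R (y - e)) ` K = {}"
proof (rule ccontr)
  assume "K \<inter> (+) (r *\<^sub>R (y - e)) ` K \<noteq> {}"
  then obtain w where w: "w \<in> K" "w - r *\<^sub>R (y - e) \<in> K" using mem_Int_translation by blast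
  have "(1 - 1 / r) *\<^sub>R k + (1 / r) *\<^sub>R w = y" if "k \<in> K" for k
  proof -
    let ?w = "(1 - 1 / r) *\<^sub>R k + (1 / r) *\<^sub>R w"
    have "?w - 1 *\<^sub>R (y - e) = (1 - 1 / r) *\<^sub>R k + (1 / r) *\<^sub>R (w - r *\<^sub>R (y - e))"
      using r by (simp add: algebra_simps)
    also have "\<dots> \<in> K" using convexD_alt[OF K(2) that w(2), of "1 / r"] r by simp
    finally have "?w \<in> K \<inter> (+) (1 *\<^sub>R (y - e)) ` K"
      unfolding mem_Int_translation using convexD_alt[OF K(2) that w(1), of "1 / r"] r by simp
    then show ?thesis
      unfolding Int_extreme_translation_eq_homothet[OF e y \<open>e \<noteq> y\<close> zero_less_one order_refl] by auto
  qed
  from this[of e] this[of y] have "(1 - 1 / r) *\<^sub>R e = (1 - 1 / r) *\<^sub>R y"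
    using e y by (metis add_right_cancel extreme_point_of_def)
  then show False using r \<open>e \<noteq> y\<close> by simp
qed

lemma cone_over_exchange:
  assumes e: "e extreme_point_of K" and y: "y extreme_point_of K" and "e \<noteq> y" and r: "0 \<le> r"
    and z: "z \<in> cone_over K" and exchange: "z + r *\<^sub>R homogeneous y - r *\<^sub>R homogeneous e \<in> cone_over K"
  shows "z - r *\<^sub>R homogeneous e \<in> cone_over K"
proof (cases "r = 0")
  case False
  have nonempty: "K \<noteq> {}" using e by (auto simp: extreme_point_of_def)
  obtain h w where w: "0 \<le> h" "w \<in> K" "z = (h, h *\<^sub>R w)"
    using z mem_cone_over_iff[OF K(2) nonempty] by (cases z) auto
  obtain w' where w': "w' \<in> K" "h *\<^sub>R w + r *\<^sub>R y - r *\<^sub>R e = h *\<^sub>R w'"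
    using exchange mem_cone_over_iff[OF K(2) nonempty] by (auto simp: w(3) homogeneous_def)
  have diff: "r *\<^sub>R (y - e) = h *\<^sub>R (w' - w)" using w'(2) by (simp add: algebra_simps)
  then have "h \<noteq> 0" using False \<open>e \<noteq> y\<close> by auto
  then have h: "0 < h" using w(1) by simp
  have "(r / h) *\<^sub>R (y - e) = (1 / h) *\<^sub>R r *\<^sub>R (y - e)" by simp
  also have "\<dots> = w' - w" unfolding diff using h by simp
  finally have w'_in: "w' \<in> K \<inter> (+) ((r / h) *\<^sub>R (y - e)) ` K"
    unfolding mem_Int_translation using w(2) w'(1) by simp
  then have "r / h \<le> 1" using Int_extreme_translation_empty[OF e y \<open>e \<noteq> y\<close>, of "r / h"] by force
  then obtain k where k: "k \<in> K" "w' = (1 - r / h) *\<^sub>R k + (r / h) *\<^sub>R y"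
    using w'_in Int_extreme_translation_eq_homothet[OF e y \<open>e \<noteq> y\<close>, of "r / h"] False r h by auto
  have "h *\<^sub>R w - r *\<^sub>R e = h *\<^sub>R w' - r *\<^sub>R y" by (simp flip: w'(2))
  also have "\<dots> = (h - r) *\<^sub>R k" unfolding k(2) using h by (simp add: algebra_simps)
  finally show ?thesis
    using k(1) \<open>r / h \<le> 1\<close> h by (auto simp: w(3) homogeneous_def mem_cone_over_iff[OF K(2) nonempty])
qed (use z in simp)

lemma cone_over_cancel:
  assumes e: "e extreme_point_of K" and y: "y extreme_point_of K" and "e \<noteq> y"
    and r: "0 \<le> r" and b: "0 \<le> b"
    and z: "z \<in> cone_over K" and sum: "z + b *\<^sub>R homogeneous y - r *\<^sub>R homogeneous e \<in> cone_over K"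
  shows "z - r *\<^sub>R homogeneous e \<in> cone_over K"
proof (cases "r = 0")
  case False
  then obtain m :: nat where "b \<le> real m * r"
    using r reals_Archimedean3[of r] by (auto intro: less_imp_le)
  then show ?thesis
    using b z sum
    \<comment> \<open>The exchange property removes \<open>y\<close> in portions of size \<open>r\<close>.\<close>
  proof (induction m arbitrary: b z)
    case (Suc m)
    have y_in: "c *\<^sub>R homogeneous y \<in> cone_over K" if "0 \<le> c" for c
      using y that by (intro scaleR_homogeneous_mem_cone_over) (auto simp: extreme_point_of_def)
    show ?case
    proof (cases "b \<le> r")
      case True
      have "z + r *\<^sub>R homogeneous y - r *\<^sub>R homogeneous e
          = (z + b *\<^sub>R homogeneous y - r *\<^sub>R homogeneous e) + (r - b) *\<^sub>R homogeneous y"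
        by (simp add: algebra_simps)
      also have "\<dots> \<in> cone_over K"
        using True Suc.prems(4) by (intro convex_cone_add convex_cone_cone_over y_in) auto
      finally show ?thesis using cone_over_exchange[OF e y \<open>e \<noteq> y\<close> r Suc.prems(3)] by blast
    next
      case False
      let ?z = "z + (b - r) *\<^sub>R homogeneous y"
      have "?z \<in> cone_over K" using False Suc.prems(3)
        by (intro convex_cone_add convex_cone_cone_over y_in) auto
      moreover have "?z + r *\<^sub>R homogeneous y - r *\<^sub>R homogeneous e \<in> cone_over K"
        using Suc.prems(4) by (simp add: algebra_simps)
      ultimately have "?z - r *\<^sub>R homogeneous e \<in> cone_over K"
        by (rule cone_over_exchange[OF e y \<open>e \<noteq> y\<close> r])
      moreover have "b - r \<le> real m * r" using Suc.prems(1) by (simp add: algebra_simps)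
      ultimately show ?thesis using Suc.IH[of "b - r" z] False Suc.prems(3) by simp
    qed
  qed simp
qed (use z in simp)

lemma extreme_point_not_below_sum:
  assumes e: "e extreme_point_of K" and "finite B" "\<And>y. y \<in> B \<Longrightarrow> y extreme_point_of K" "e \<notin> B"
    "\<And>y. y \<in> B \<Longrightarrow> 0 \<le> b y" and r: "0 \<le> r"
    and "(\<Sum>y\<in>B. b y *\<^sub>R homogeneous y) - r *\<^sub>R homogeneous e \<in> cone_over K"
  shows "r = 0"
  using assms(2-5,7)
proof (induction B)
  case empty
  have "K \<noteq> {}" using e by (auto simp: extreme_point_of_def)
  then show ?case using empty.prems(4) r K(2) by (simp add: mem_cone_over_iff homogeneous_def)
next
  case (insert y B)
  let ?S = "\<Sum>y\<in>B. b y *\<^sub>R homogeneous y"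
  have "?S \<in> cone_over K"
    using insert.prems(1,3) by (intro sum_homogeneous_mem_cone_over) (auto simp: extreme_point_of_def)
  moreover have "?S + b y *\<^sub>R homogeneous y - r *\<^sub>R homogeneous e \<in> cone_over K"
    using insert.prems(4) unfolding sum.insert[OF insert.hyps] add.commute[of ?S] .
  moreover have "y extreme_point_of K" "e \<noteq> y" "0 \<le> b y" using insert.prems(1-3) by auto
  ultimately have "?S - r *\<^sub>R homogeneous e \<in> cone_over K" using cone_over_cancel[OF e _ _ r] by blast
  then show ?case by (rule insert.IH[rotated 3]) (use insert.prems(1-3) in simp_all)
qed

end

lemma affine_independent_extreme_points:
  fixes K :: "'a::euclidean_space set"
  assumes K: "compact K" "convex K" "homothetic_intersections K"
  shows "\<not> affine_dependent {v. v extreme_point_of K}"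
proof
  assume "affine_dependent {v. v extreme_point_of K}"
  then obtain S U where S: "finite S" "\<And>v. v \<in> S \<Longrightarrow> v extreme_point_of K"
    and U: "sum U S = 0" "\<exists>v\<in>S. U v \<noteq> 0" "(\<Sum>v\<in>S. U v *\<^sub>R v) = 0"
    unfolding affine_dependent_explicit by blast
  have "\<exists>e\<in>S. 0 < U e"
  proof (rule ccontr)
    assume "\<not> (\<exists>e\<in>S. 0 < U e)"
    then have "\<forall>v\<in>S. U v = 0"
      using U(1) S(1) sum_nonneg_eq_0_iff[of S "\<lambda>v. - U v"] by (auto simp: sum_negf not_less)
    then show False using U(2) by blast
  qed
  then obtain e where e: "e \<in> S" "0 < U e" by blast
  define B where "B = {v \<in> S. U v < 0}"
  define P where "P = S - B - {e}"
  have B: "finite B" "e \<notin> B" "B \<subseteq> S" using S e by (auto simp: B_def)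
  have split: "S = insert e B \<union> P" "insert e B \<inter> P = {}" "finite P" using S e B by (auto simp: P_def)
  have "(\<Sum>v\<in>insert e B. U v *\<^sub>R homogeneous v) + (\<Sum>v\<in>P. U v *\<^sub>R homogeneous v)
      = (\<Sum>v\<in>S. U v *\<^sub>R homogeneous v)"
    unfolding split(1) using B(1) split(2,3) by (intro sum.union_disjoint[symmetric]) auto
  also have "\<dots> = 0" using U by (simp add: homogeneous_def sum_prod zero_prod_def)
  finally have balance: "(\<Sum>v\<in>insert e B. U v *\<^sub>R homogeneous v) + (\<Sum>v\<in>P. U v *\<^sub>R homogeneous v) = 0" .
  have "(\<Sum>v\<in>B. (- U v) *\<^sub>R homogeneous v) - U e *\<^sub>R homogeneous e
      = - (\<Sum>v\<in>insert e B. U v *\<^sub>R homogeneous v)"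
    using B(1,2) by (simp add: sum_negf)
  also have "\<dots> = (\<Sum>v\<in>P. U v *\<^sub>R homogeneous v)" using balance by (rule minus_unique)
  also have "\<dots> \<in> cone_over K"
    using S by (intro sum_homogeneous_mem_cone_over) (auto simp: P_def B_def extreme_point_of_def)
  finally have "U e = 0"
    using S B e by (intro extreme_point_not_below_sum[OF K, of e B "\<lambda>v. - U v" "U e"]) (auto simp: B_def)
  then show False using e by simp
qed

lemma simplex_of_homothetic_intersections:
  fixes K :: "'a::euclidean_space set"
  assumes body: "convex_body K" and homothetic: "homothetic_intersections K"
  shows "(int DIM('a)) simplex K"
proof -
  note K = convex_bodyD[OF body]
  let ?E = "{v. v extreme_point_of K}"
  have hull: "K = convex hull ?E" by (rule Krein_Milman_Minkowski[OF K(1,2)])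
  have independent: "\<not> affine_dependent ?E"
    by (rule affine_independent_extreme_points[OF K(1,2) homothetic])
  have "int (card ?E) - 1 = aff_dim ?E" using aff_dim_affine_independent[OF independent] by simp
  also have "\<dots> = aff_dim K" by (subst (2) hull) (simp add: aff_dim_convex_hull)
  also have "\<dots> = int DIM('a)" using K(4) by (rule aff_dim_nonempty_interior)
  finally show ?thesis unfolding simplex_def using independent hull by (intro exI[of _ ?E]) auto
qed

lemma scaleR_convex_hull_finite:
  assumes "finite C" "C \<noteq> {}" "0 \<le> c"
  shows "(*\<^sub>R) c ` (convex hull C) = {\<Sum>v\<in>C. f v *\<^sub>R v | f. (\<forall>v\<in>C. 0 \<le> f v) \<and> sum f C = c}"
proof (intro set_eqI iffI)
  fix z assume "z \<in> (*\<^sub>R) c ` (convex hull C)"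
  then obtain g where "\<forall>v\<in>C. 0 \<le> g v" "sum g C = 1" "z = c *\<^sub>R (\<Sum>v\<in>C. g v *\<^sub>R v)"
    unfolding convex_hull_finite[OF assms(1)] by blast
  then show "z \<in> {\<Sum>v\<in>C. f v *\<^sub>R v | f. (\<forall>v\<in>C. 0 \<le> f v) \<and> sum f C = c}"
    using assms(3) by (intro CollectI exI[of _ "\<lambda>v. c * g v"])
      (simp add: scaleR_sum_right flip: sum_distrib_left)
next
  fix z assume "z \<in> {\<Sum>v\<in>C. f v *\<^sub>R v | f. (\<forall>v\<in>C. 0 \<le> f v) \<and> sum f C = c}"
  then obtain f where f: "\<forall>v\<in>C. 0 \<le> f v" "sum f C = c" "z = (\<Sum>v\<in>C. f v *\<^sub>R v)" by blast
  show "z \<in> (*\<^sub>R) c ` (convex hull C)"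
  proof (cases "c = 0")
    case True
    then have "\<forall>v\<in>C. f v = 0" using f assms(1) by (simp add: sum_nonneg_eq_0_iff)
    then show ?thesis using True f(3) assms(2) by (auto simp: image_iff)
  next
    case False
    then have "(\<Sum>v\<in>C. (f v / c) *\<^sub>R v) \<in> convex hull C"
      using f assms unfolding convex_hull_finite[OF assms(1)]
      by (intro CollectI exI[of _ "\<lambda>v. f v / c"]) (auto simp flip: sum_divide_distrib)
    moreover have "z = c *\<^sub>R (\<Sum>v\<in>C. (f v / c) *\<^sub>R v)" using False f(3) by (simp add: scaleR_sum_right)
    ultimately show ?thesis by blast
  qed
qed

lemma affine_independent_coordinates_unique:
  assumes "finite C" "\<not> affine_dependent C" "sum f C = sum g C"
    "(\<Sum>v\<in>C. f v *\<^sub>R v) = (\<Sum>v\<in>C. g v *\<^sub>R v)" "v \<in> C"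
  shows "f v = g v"
proof (rule ccontr)
  assume "f v \<noteq> g v"
  moreover have "sum (\<lambda>v. f v - g v) C = 0" "(\<Sum>v\<in>C. (f v - g v) *\<^sub>R v) = 0"
    using assms(3,4) by (simp_all add: sum_subtractf scaleR_diff_left)
  ultimately have "affine_dependent C"
    unfolding affine_dependent_explicit_finite[OF assms(1)] using assms(5)
    by (intro exI[of _ "\<lambda>v. f v - g v"]) auto
  then show False using assms(2) by blast
qed

lemma Int_translation_convex_hull_finite:
  fixes a :: "'a::real_vector \<Rightarrow> real"
  assumes C: "finite C" "\<not> affine_dependent C" and a: "sum a C = 0"
  shows "convex hull C \<inter> (+) (\<Sum>v\<in>C. a v *\<^sub>R v) ` (convex hull C)
    = {\<Sum>v\<in>C. f v *\<^sub>R v | f. (\<forall>v\<in>C. max 0 (a v) \<le> f v) \<and> sum f C = 1}" (is "?K \<inter> (+) ?x ` ?K = ?R")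
proof (intro set_eqI iffI)
  fix z assume "z \<in> ?K \<inter> (+) ?x ` ?K"
  then have z: "z \<in> ?K" "z - ?x \<in> ?K" unfolding mem_Int_translation by simp_all
  obtain f where f: "\<forall>v\<in>C. 0 \<le> f v" "sum f C = 1" "z = (\<Sum>v\<in>C. f v *\<^sub>R v)"
    using z(1) unfolding convex_hull_finite[OF C(1)] by blast
  obtain h where h: "\<forall>v\<in>C. 0 \<le> h v" "sum h C = 1" "z - ?x = (\<Sum>v\<in>C. h v *\<^sub>R v)"
    using z(2) unfolding convex_hull_finite[OF C(1)] by (elim CollectE exE conjE) simp
  have "f v = h v + a v" if "v \<in> C" for v
  proof (rule affine_independent_coordinates_unique[OF C _ _ that])
    show "sum f C = (\<Sum>v\<in>C. h v + a v)" using f(2) h(2) a by (simp add: sum.distrib)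
    show "(\<Sum>v\<in>C. f v *\<^sub>R v) = (\<Sum>v\<in>C. (h v + a v) *\<^sub>R v)"
      using h(3) by (simp add: f(3) scaleR_add_left sum.distrib diff_eq_eq)
  qed
  then have "\<forall>v\<in>C. max 0 (a v) \<le> f v" using f(1) h(1) by simp
  then show "z \<in> ?R" using f(2,3) by blast
next
  fix z assume "z \<in> ?R"
  then obtain f where f: "\<forall>v\<in>C. max 0 (a v) \<le> f v" "sum f C = 1" "z = (\<Sum>v\<in>C. f v *\<^sub>R v)" by blast
  have "z \<in> ?K" using f unfolding convex_hull_finite[OF C(1)] by auto
  moreover have "z - ?x \<in> ?K"
    unfolding convex_hull_finite[OF C(1)] using f a
    by (intro CollectI exI[of _ "\<lambda>v. f v - a v"]) (simp add: sum_subtractf scaleR_diff_left)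
  ultimately show "z \<in> ?K \<inter> (+) ?x ` ?K" by (simp only: mem_Int_translation)
qed

lemma Int_translation_convex_hull_homothet:
  fixes a :: "'a::real_vector \<Rightarrow> real"
  assumes C: "finite C" "C \<noteq> {}" "\<not> affine_dependent C" and a: "sum a C = 0"
  defines "K \<equiv> convex hull C" and "x \<equiv> \<Sum>v\<in>C. a v *\<^sub>R v" and "d \<equiv> \<lambda>v. max 0 (a v)"
  defines "c \<equiv> 1 - sum d C"
  assumes c: "0 \<le> c"
  shows "K \<inter> (+) x ` K = (\<lambda>k. c *\<^sub>R k + (\<Sum>v\<in>C. d v *\<^sub>R v)) ` K"
proof -
  let ?q = "\<Sum>v\<in>C. d v *\<^sub>R v"
  have "K \<inter> (+) x ` K = {\<Sum>v\<in>C. f v *\<^sub>R v | f. (\<forall>v\<in>C. d v \<le> f v) \<and> sum f C = 1}"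
    unfolding K_def x_def d_def by (rule Int_translation_convex_hull_finite[OF C(1,3) a])
  also have "\<dots> = (\<lambda>z. z + ?q) ` {\<Sum>v\<in>C. g v *\<^sub>R v | g. (\<forall>v\<in>C. 0 \<le> g v) \<and> sum g C = c}"
  proof (intro set_eqI iffI; clarify)
    fix f assume "\<forall>v\<in>C. d v \<le> f v" "sum f C = 1"
    then show "(\<Sum>v\<in>C. f v *\<^sub>R v) \<in> (\<lambda>z. z + ?q) ` {\<Sum>v\<in>C. g v *\<^sub>R v | g. (\<forall>v\<in>C. 0 \<le> g v) \<and> sum g C = c}"
      by (intro image_eqI[of _ _ "\<Sum>v\<in>C. (f v - d v) *\<^sub>R v"] CollectI exI[of _ "\<lambda>v. f v - d v"])
        (auto simp: c_def scaleR_diff_left sum_subtractf)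
  next
    fix g assume "\<forall>v\<in>C. 0 \<le> g v" "c = sum g C"
    then show "\<exists>f. (\<Sum>v\<in>C. g v *\<^sub>R v) + ?q = (\<Sum>v\<in>C. f v *\<^sub>R v) \<and> (\<forall>v\<in>C. d v \<le> f v) \<and> sum f C = 1"
      by (intro exI[of _ "\<lambda>v. g v + d v"]) (auto simp: c_def scaleR_add_left sum.distrib)
  qed
  also have "\<dots> = (\<lambda>k. c *\<^sub>R k + ?q) ` K"
    unfolding scaleR_convex_hull_finite[OF C(1,2) c, symmetric] by (simp add: image_image K_def)
  finally show ?thesis .
qed

lemma homothetic_intersections_simplex:
  fixes K :: "'a::euclidean_space set"
  assumes "(int DIM('a)) simplex K"
  shows "homothetic_intersections K"
  unfolding homothetic_intersections_def
proof (intro allI impI)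
  fix x :: 'a assume x: "x \<noteq> 0" "K \<inter> (+) x ` K \<noteq> {}"
  obtain C where C: "\<not> affine_dependent C" "int (card C) = int DIM('a) + 1" and K: "K = convex hull C"
    using assms unfolding simplex_def by blast
  have finite: "finite C" "C \<noteq> {}" using C by (auto intro: aff_independent_finite)
  have "aff_dim C = int DIM('a)" using aff_dim_affine_independent[OF C(1)] C(2) by simp
  then have "x \<in> affine hull C" "0 \<in> affine hull C" by (simp_all add: aff_dim_eq_full)
  then obtain u u' where u: "sum u C = 1" "(\<Sum>v\<in>C. u v *\<^sub>R v) = x" "sum u' C = 1" "(\<Sum>v\<in>C. u' v *\<^sub>R v) = 0"
    unfolding affine_hull_finite[OF finite(1)] by blast
  define a where "a v = u v - u' v" for v
  have a: "sum a C = 0" "x = (\<Sum>v\<in>C. a v *\<^sub>R v)"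
    using u by (simp_all add: a_def sum_subtractf scaleR_diff_left)
  define c where "c = 1 - (\<Sum>v\<in>C. max 0 (a v))"
  obtain f where "\<forall>v\<in>C. max 0 (a v) \<le> f v" "sum f C = 1"
    using x(2) unfolding K a(2) Int_translation_convex_hull_finite[OF finite(1) C(1) a(1)] by blast
  then have "0 \<le> c" using sum_mono[of C "\<lambda>v. max 0 (a v)" f] by (simp add: c_def)
  moreover have "c < 1"
  proof -
    have "\<exists>v\<in>C. 0 < max 0 (a v)"
    proof (rule ccontr)
      assume "\<not> (\<exists>v\<in>C. 0 < max 0 (a v))"
      then have "\<forall>v\<in>C. a v = 0"
        using a(1) finite(1) sum_nonneg_eq_0_iff[of C "\<lambda>v. - a v"] by (auto simp: sum_negf not_less)
      then show False using a(2) x(1) by simp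
    qed
    then have "0 < (\<Sum>v\<in>C. max 0 (a v))" using finite(1) by (auto intro: sum_pos2)
    then show ?thesis by (simp add: c_def)
  qed
  moreover have "K \<inter> (+) x ` K = (\<lambda>k. c *\<^sub>R k + (\<Sum>v\<in>C. max 0 (a v) *\<^sub>R v)) ` K"
    unfolding K a(2) c_def
    by (rule Int_translation_convex_hull_homothet[OF finite C(1) a(1)])
      (use \<open>0 \<le> c\<close> in \<open>simp add: c_def\<close>)
  ultimately show "\<exists>c v. 0 \<le> c \<and> c < 1 \<and> K \<inter> (+) x ` K = (\<lambda>k. c *\<^sub>R k + v) ` K" by blast
qed

theorem simplex_iff_homothetic_intersections:
  fixes K :: "'a::euclidean_space set"
  assumes "convex_body K"
  shows "(int DIM('a)) simplex K \<longleftrightarrow> homothetic_intersections K"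
  using assms homothetic_intersections_simplex simplex_of_homothetic_intersections by blast

subsection \<open>The equality case\<close>

context convex_body_pair
begin

lemma slice_reflect_translate:
  assumes "K = reflect_translate z L"
  shows "slice (z + x) = K \<inter> (+) x ` K"
proof -
  have "w - x \<in> K \<longleftrightarrow> z + x - w \<in> L" for w
    using mem_reflect_translate[of "w - x" z L] assms by (simp add: algebra_simps)
  then show ?thesis by (auto simp only: slice_def Int_iff mem_reflect_translate
      mem_Int_translation[unfolded Int_iff] set_eq_iff)
qed

lemma max_root_reflect_translate:
  assumes "K = reflect_translate z L"
  shows "vol_root K = max_root" "vol_root L = max_root"
proof -
  have "slice (z + 0) = K" using slice_reflect_translate[OF assms, of 0] by simp
  then show "vol_root K = max_root" using max_root_le(1) vol_root_slice_le_max_root[of "z + 0"] by simp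
  then show "vol_root L = max_root"
    using vol_reflect_translate[of z L] by (simp add: vol_root_def flip: assms)
qed

lemma mem_level_reflect_translate:
  assumes "K = reflect_translate z L" and "0 \<le> s"
  shows "z + x \<in> level s \<longleftrightarrow> x \<in> difference_body K \<and> s * vol_root K \<le> vol_root (K \<inter> (+) x ` K)"
proof -
  note slice = slice_reflect_translate[OF assms(1)]
  have "z + x \<in> minkowski_sum K L \<longleftrightarrow> x \<in> difference_body K"
    using slice_empty_iff[of "z + x"] slice[of x] difference_body_iff[of x K] by blast
  then show ?thesis using assms(2)
    by (simp only: mem_level_iff slice max_root_reflect_translate(1)[OF assms(1)])
qed

lemma linear_covariogram_of_linear_levels:
  assumes K_eq: "K = reflect_translate z L" and linear: linear_levels
  shows "linear_covariogram K"
  unfolding linear_covariogram_def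
proof (intro allI impI)
  note mem_level = mem_level_reflect_translate[OF K_eq]
  fix x s assume s: "0 < s" "s < 1" "s * vol_root K \<le> vol_root (K \<inter> (+) x ` K)"
  have "z + 0 \<in> level 1" using mem_level[of 1 0] bodies(3) interior_subset
    by (auto simp: difference_body_iff)
  then have level: "level s = (\<lambda>w. (1 - s) *\<^sub>R w + s *\<^sub>R z) ` minkowski_sum K L"
    using s by (intro level_eq_homothet linear) auto
  have "0 < s * vol_root K" using s vol_root_pos by simp
  then have "K \<inter> (+) x ` K \<noteq> {}" using s by (auto simp: vol_root_def)
  then have "z + x \<in> level s" using s mem_level[of s x] by (simp add: difference_body_iff)
  then obtain w where w: "w \<in> minkowski_sum K L" "z + x = (1 - s) *\<^sub>R w + s *\<^sub>R z"
    unfolding level by blast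
  have "w - z \<in> difference_body K" using w(1) mem_level[of 0 "w - z"] by (simp add: level_0)
  moreover have "x = (1 - s) *\<^sub>R (w - z)" using w(2) by (simp add: algebra_simps)
  ultimately show "x \<in> (*\<^sub>R) (1 - s) ` difference_body K" by blast
qed

lemma linear_levels_of_linear_covariogram:
  assumes K_eq: "K = reflect_translate z L" and linear: "linear_covariogram K"
  shows linear_levels
  unfolding linear_levels_def
proof (intro allI impI)
  note mem_level = mem_level_reflect_translate[OF K_eq]
  fix s :: real assume s: "0 \<le> s" "s < 1"
  show "vol_root (level s) = (1 - s) * vol_root (level 0)"
  proof (cases "s = 0")
    case False
    have "level s \<subseteq> (\<lambda>w. (1 - s) *\<^sub>R w + s *\<^sub>R z) ` minkowski_sum K L"
    proof
      fix y assume "y \<in> level s"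
      then have "s * vol_root K \<le> vol_root (K \<inter> (+) (y - z) ` K)" using mem_level[of s "y - z"] s by simp
      then obtain x where x: "x \<in> difference_body K" "y - z = (1 - s) *\<^sub>R x"
        using linear s False unfolding linear_covariogram_def by (metis imageE less_eq_real_def)
      then have "z + x \<in> minkowski_sum K L" using mem_level[of 0 x] by (simp add: level_0)
      moreover have "y = (1 - s) *\<^sub>R (z + x) + s *\<^sub>R z" using x(2) by (simp add: algebra_simps)
      ultimately show "y \<in> (\<lambda>w. (1 - s) *\<^sub>R w + s *\<^sub>R z) ` minkowski_sum K L" by blast
    qed
    then have "vol_root (level s) \<le> vol_root ((\<lambda>w. (1 - s) *\<^sub>R w + s *\<^sub>R z) ` minkowski_sum K L)"
      using s by (intro vol_root_mono compact_level compact_continuous_image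
        continuous_intros compact_minkowski_sum)
    also have "\<dots> = (1 - s) * vol_root (level 0)" using s by (simp add: vol_root_affine level_0)
    finally show ?thesis using vol_root_level_ge_linear[of s] s by simp
  qed simp
qed

theorem vol_root_level_eq_iff_simplex:
  assumes t: "3/4 \<le> t" "t < 1"
  shows "vol_root (level t) = 1/2 * central_binomial_root DIM('a) * (1 - t) * (vol_root K + vol_root L)
    \<longleftrightarrow> (\<exists>z. K = reflect_translate z L) \<and> (int DIM('a)) simplex K"
proof -
  have linear_iff: "linear_covariogram K \<longleftrightarrow> (int DIM('a)) simplex K"
    unfolding simplex_iff_homothetic_intersections[OF K]
    using linear_covariogramI_homothetic[OF K] homothetic_intersections_of_linear_covariogram[OF K]
    by blast
  have "vol_root K = max_root \<and> vol_root L = max_root \<longleftrightarrow> (\<exists>z. K = reflect_translate z L)"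
    using max_root_reflect_translate eq_reflect_translate_of_max_root level_1_nonempty by blast
  then show ?thesis
    unfolding vol_root_level_ge_sum(2)[OF t] linear_iff[symmetric]
    using linear_covariogram_of_linear_levels linear_levels_of_linear_covariogram by blast
qed

corollary vol_root_conv_body_ge:
  assumes "(3/4) ^ DIM('a) \<le> \<theta>" "\<theta> \<le> 1"
  shows "1/2 * central_binomial_root DIM('a) * (1 - root DIM('a) \<theta>) * (vol_root K + vol_root L)
    \<le> vol_root (conv_body K \<theta> L)"
proof (cases "\<theta> = 1")
  case False
  have "0 \<le> \<theta>" by (rule order_trans[OF _ assms(1)]) simp
  moreover have "3/4 \<le> root DIM('a) \<theta>" using assms(1) le_root_iff[of "DIM('a)" "3/4" \<theta>] by simp
  ultimately show ?thesis
    using assms(2) False vol_root_level_ge_sum(1)[of "root DIM('a) \<theta>"] by (simp add: conv_body_eq_level)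
qed simp

corollary vol_root_conv_body_ge_interpolation:
  assumes "0 \<le> \<theta>" "\<theta> \<le> (3/4) ^ DIM('a)"
  shows "(1 - (4/3 - 1/6 * central_binomial_root DIM('a)) * root DIM('a) \<theta>) * (vol_root K + vol_root L)
    \<le> vol_root (conv_body K \<theta> L)"
proof -
  have "root DIM('a) \<theta> \<le> 3/4" using assms(2) root_le_iff[of "DIM('a)" "3/4" \<theta>] by simp
  then show ?thesis
    using assms(1) vol_root_level_ge_interpolation[of "root DIM('a) \<theta>"] by (simp add: conv_body_eq_level)
qed

corollary vol_root_conv_body_eq_iff_simplex:
  assumes "(3/4) ^ DIM('a) \<le> \<theta>" "\<theta> < 1"
  shows "vol_root (conv_body K \<theta> L)
      = 1/2 * central_binomial_root DIM('a) * (1 - root DIM('a) \<theta>) * (vol_root K + vol_root L)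
    \<longleftrightarrow> (\<exists>z. K = reflect_translate z L) \<and> (int DIM('a)) simplex K"
proof -
  have "0 \<le> \<theta>" by (rule order_trans[OF _ assms(1)]) simp
  moreover have "3/4 \<le> root DIM('a) \<theta>" using assms(1) le_root_iff[of "DIM('a)" "3/4" \<theta>] by simp
  ultimately show ?thesis
    using assms(2) vol_root_level_eq_iff_simplex[of "root DIM('a) \<theta>"]
    by (simp only: conv_body_eq_level) simp
qed

end

theorem theorem1p1:
  fixes K L :: "'a::euclidean_space set"
  defines "n \<equiv> DIM('a)"
  assumes K: "convex_body K" and L: "convex_body L"
  shows "(\<forall>\<theta>::real. (3/4) ^ n \<le> \<theta> \<and> \<theta> \<le> 1 \<longrightarrow>
           vol (conv_body K \<theta> L) powr (1 / real n)
             \<ge> 1/2 * real ((2*n) choose n) powr (1 / real n) * (1 - \<theta> powr (1 / real n))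
               * (vol K powr (1 / real n) + vol L powr (1 / real n)))
      \<and> (\<forall>\<theta>::real. 0 \<le> \<theta> \<and> \<theta> \<le> (3/4) ^ n \<longrightarrow>
           vol (conv_body K \<theta> L) powr (1 / real n)
             \<ge> (1 - (4/3 - 1/6 * real ((2*n) choose n) powr (1 / real n)) * \<theta> powr (1 / real n))
               * (vol K powr (1 / real n) + vol L powr (1 / real n)))
      \<and> (\<forall>\<theta>::real. (3/4) ^ n \<le> \<theta> \<and> \<theta> < 1 \<longrightarrow>
           (vol (conv_body K \<theta> L) powr (1 / real n)
              = 1/2 * real ((2*n) choose n) powr (1 / real n) * (1 - \<theta> powr (1 / real n))
                * (vol K powr (1 / real n) + vol L powr (1 / real n))
            \<longleftrightarrow> (\<exists>v. K = (\<lambda>y. v - y) ` L) \<and> (int n) simplex K))"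
proof -
  interpret convex_body_pair K L using K L by unfold_locales
  have vol: "vol S powr (1 / real n) = vol_root S" for S :: "'a set"
    by (simp add: n_def vol_root_eq_powr)
  have root: "x powr (1 / real n) = root n x" if "0 \<le> x" for x
    using that by (simp add: n_def root_powr_inverse)
  have nonneg: "0 \<le> \<theta>" if "(3/4) ^ n \<le> \<theta>" for \<theta> :: real
    by (rule order_trans[OF _ that]) simp
  have binomial: "root n (real ((2*n) choose n)) = central_binomial_root n"
    by (simp add: central_binomial_root_def)
  note bounds = vol_root_conv_body_ge vol_root_conv_body_ge_interpolation
    vol_root_conv_body_eq_iff_simplex
  show ?thesis
    unfolding vol root[OF of_nat_0_le_iff] binomial reflect_translate_def[symmetric]
    using bounds[folded n_def] by (auto simp: root nonneg)
qed

end
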